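(* Let $\tau>0$, let $\mathscr{T}_h$ be a triangulation of $\Omega$ of any mesh size $h>0$, let $\epsilon<1$, let $\overline{\phi}_0\in\mathbb{R}$, and let the penalty parameter $\alpha\ge 1$ be large enough that the coercivity inequality stated in the context holds. Let $\phi_h^{m-1}\in Z_h$ have average $\frac{1}{|\Omega|}(\phi_h^{m-1},1)=\overline{\phi}_0$ and set $\varphi_h^{m-1}:=\phi_h^{m-1}-\overline{\phi}_0\in\mathring{Z}_h$. Consider the following two problems. Problem (A): find $(\varphi_h^m,\mu_{h,\star}^m)\in\mathring{Z}_h\times\mathring{V}_h$ such that $$a_h^{IP}(\varphi_h^m,\psi_h)+\big((\varphi_h^m+\overline{\phi}_0)^3,\psi_h\big)+(1-\epsilon)(\varphi_h^m+\overline{\phi}_0,\psi_h)-(\mu_{h,\star}^m,\psi_h)=2(\nabla\varphi_h^{m-1},\nabla\psi_h)\quad\forall\,\psi_h\in\mathring{Z}_h,$$ $$(\nabla\mu_{h,\star}^m,\nabla\nu_h)=-\Big(\frac{\varphi_h^m-\varphi_h^{m-1}}{\tau},\nu_h\Big)\quad\forall\,\nu_h\in\mathring{V}_h.$$ Problem (B): find $(\phi_h^m,\mu_h^m)\in Z_h\times V_h$ such that $$\Big(\frac{\phi_h^m-\phi_h^{m-1}}{\tau},\nu_h\Big)+(\nabla\mu_h^m,\nabla\nu_h)=0\quad\forall\,\nu_h\in V_h,$$ $$a_h^{IP}(\phi_h^m,\psi_h)+\big((\phi_h^m)^3+(1-\epsilon)\phi_h^m,\psi_h\big)-2(\nabla\phi_h^{m-1},\nabla\psi_h)-(\mu_h^m,\psi_h)=0\quad\forall\,\psi_h\in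 Z_h.$$ Then: (i) Problem (A) has a unique solution. (ii) Problems (A) and (B) are equivalent: $(\varphi_h^m,\mu_{h,\star}^m)\in\mathring{Z}_h\times\mathring{V}_h$ solves (A) if and only if $(\phi_h^m,\mu_h^m)\in Z_h\times V_h$ given by $$\phi_h^m=\varphi_h^m+\overline{\phi}_0,\qquad \mu_h^m=\mu_{h,\star}^m+\frac{1}{|\Omega|}\big((\varphi_h^m+\overline{\phi}_0)^3,1\big)+(1-\epsilon)\overline{\phi}_0$$ solves (B), and this gives a one-to-one correspondence between the solution sets of (A) and (B). (iii) Consequently, Problem (B) has a unique solution.
   Context: $\Omega\subset\mathbb{R}^2$ is a bounded open polygonal domain; $(\cdot,\cdot)$ is the $L^2(\Omega)$ inner product. $\mathscr{T}_h$ is a geometrically conforming, locally quasi-uniform simplicial triangulation of $\Omega$, $h=\max_{K\in\mathscr{T}_h}\operatorname{diam}K$, $\mathscr{E}_h$ is the set of edges of the triangles, $|e|$ is the length of an edge $e$. $V_h=\{v\in C(\overline\Omega): v|_K\in P_1(K)\ \forall K\in\mathscr{T}_h\}$, $Z_h=\{v\in C(\overline\Omega): v|_K\in P_2(K)\ \forall K\in\mathscr{T}_h\}$, $L_0^2(\Omega)=\{v\in L^2(\Omega):(v,1)=0\}$, $\mathring{V}_h=V_h\cap L_0^2(\Omega)$, $\mathring{Z}_h=Z_h\cap L_0^2(\Omega)$. For an interior edge $e$ shared by triangles $K_\pm$, with unit normal $n_e$ pointing from $K_-$ to $K_+$ and $v_\pm=v|_{K_\pm}$, set $[\![\partial v/\partial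 n_e]\!]=n_e\cdot(\nabla v_+-\nabla v_-)$ and $\{\!\{\partial^2v/\partial n_e^2\}\!\}=\frac12\big(\partial^2v_-/\partial n_e^2+\partial^2v_+/\partial n_e^2\big)$, where $\partial^2u/\partial n_e^2=n_e\cdot(\nabla^2u)n_e$. For a boundary edge, with $n_e$ the outward unit normal to $\Omega$, set $[\![\partial v/\partial n_e]\!]=-n_e\cdot\nabla v$ and $\{\!\{\partial^2v/\partial n_e^2\}\!\}=n_e\cdot(\nabla^2v)n_e$. With penalty parameter $\alpha\ge1$, $$a_h^{IP}(w,v)=\sum_{K\in\mathscr{T}_h}\int_K\nabla^2w:\nabla^2v\,dx+\sum_{e\in\mathscr{E}_h}\int_e\Big\{\!\!\Big\{\frac{\partial^2w}{\partial n_e^2}\Big\}\!\!\Big\}\Big[\!\!\Big[\frac{\partial v}{\partial n_e}\Big]\!\!\Big]dS+\sum_{e\in\mathscr{E}_h}\int_e\Big\{\!\!\Big\{\frac{\partial^2v}{\partial n_e^2}\Big\}\!\!\Big\}\Big[\!\!\Big[\frac{\partial w}{\partial n_e}\Big]\!\!\Big]dS+\alpha\sum_{e\in\mathscr{E}_h}\frac1{|e|}\int_e\Big[\!\!\Big[\frac{\partial w}{\partial n_e}\Big]\!\!\Big]\Big[\!\!\Big[\frac{\partial v}{\partial n_e}\Big]\!\!\Big]dS,$$ and $\|v\|_{2,h}^2=\sum_{K}|v|_{H^2(K)}^2+\sum_{e}\frac{\alpha}{|e|}\|[\![\partial v/\partial n_e]\!]\|_{L^2(e)}^2$. Coercivity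 (known for $\alpha$ large enough): there is a constant $C_{coer}>0$, depending only on the shape regularity of $\mathscr{T}_h$, with $C_{coer}\|w_h\|_{2,h}^2\le a_h^{IP}(w_h,w_h)$ for all $w_h\in Z_h$. *)

theory Defs
  imports "HOL-Analysis.Analysis"
begin

section \<open>Polygonal domains and triangulations\<close>

text \<open>The last conjunct says that the domain lies on one side of its boundary (no slits), so that
  the outward normal makes sense on every boundary edge. Holes are allowed.\<close>

definition polygonal_domain :: "(real^2) set \<Rightarrow> bool" where
  "polygonal_domain \<Omega> \<longleftrightarrow>
     open \<Omega> \<and> connected \<Omega> \<and> bounded \<Omega> \<and> \<Omega> \<noteq> {} \<and>
     (\<exists>\<S>. finite \<S> \<and> (\<forall>S\<in>\<S>. \<exists>a b. S = closed_segment a b) \<and> frontier \<Omega> = \<Union>\<S>) \<and>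
     interior (closure \<Omega>) = \<Omega>"

text \<open>Triangles are closed sets. The library predicate \<^const>\<open>triangulation\<close> contains the
  conformity condition: two triangles meet in a common face (possibly empty).\<close>

definition triangulates :: "(real^2) set set \<Rightarrow> (real^2) set \<Rightarrow> bool" where
  "triangulates \<T> \<Omega> \<longleftrightarrow>
     triangulation \<T> \<and> (\<forall>K\<in>\<T>. 2 simplex K) \<and> \<Union>\<T> = closure \<Omega>"

definition mesh_size :: "(real^2) set set \<Rightarrow> real" where
  "mesh_size \<T> = (MAX K\<in>\<T>. diameter K)"

text \<open>Shape regularity (the inradius is comparable with the diameter) and comparable diameters of
  neighbouring triangles, with a quantitative constant.\<close>

definition locally_quasi_uniform :: "real \<Rightarrow> (real^2) set set \<Rightarrow> bool" where
  "locally_quasi_uniform \<kappa> \<T> \<longleftrightarrow>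
     \<kappa> > 0 \<and>
     (\<forall>K\<in>\<T>. \<exists>z. cball z (diameter K / \<kappa>) \<subseteq> K) \<and>
     (\<forall>K\<in>\<T>. \<forall>K'\<in>\<T>. K \<inter> K' \<noteq> {} \<longrightarrow> diameter K \<le> \<kappa> * diameter K')"

definition edges :: "(real^2) set set \<Rightarrow> (real^2) set set" where
  "edges \<T> = {e. \<exists>K\<in>\<T>. e edge_of K}"

definition interior_edge :: "(real^2) set set \<Rightarrow> (real^2) set \<Rightarrow> bool" where
  "interior_edge \<T> e \<longleftrightarrow>
     (\<exists>K\<in>\<T>. \<exists>K'\<in>\<T>. K \<noteq> K' \<and> e edge_of K \<and> e edge_of K')"

text \<open>The unit normal to an edge \<open>e\<close> of \<open>K\<close> pointing out of \<open>K\<close>. Taking \<open>y\<close> in \<open>e\<close> shows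
  that the vector is orthogonal to \<open>e\<close>.\<close>

definition outer_normal :: "(real^2) set \<Rightarrow> (real^2) set \<Rightarrow> real^2" where
  "outer_normal K e = (THE n. norm n = 1 \<and> (\<forall>x\<in>e. \<forall>y\<in>K. n \<bullet> (y - x) \<le> 0))"

text \<open>A choice of \<open>(K\<^sub>-, K\<^sub>+)\<close> for an interior edge; jumps and averages do not depend on it.
  The normal \<open>n\<^sub>e\<close> from \<open>K\<^sub>-\<close> to \<open>K\<^sub>+\<close> is the outer normal of \<open>K\<^sub>-\<close>.\<close>

definition edge_pair :: "(real^2) set set \<Rightarrow> (real^2) set \<Rightarrow> (real^2) set \<times> (real^2) set" where
  "edge_pair \<T> e = (SOME (Km, Kp). Km \<in> \<T> \<and> Kp \<in> \<T> \<and> Km \<noteq> Kp \<and> e edge_of Km \<and> e edge_of Kp)"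

definition boundary_triangle :: "(real^2) set set \<Rightarrow> (real^2) set \<Rightarrow> (real^2) set" where
  "boundary_triangle \<T> e = (THE K. K \<in> \<T> \<and> e edge_of K)"


section \<open>Integrals and derivatives\<close>

text \<open>Covers both scalar functions (where \<open>\<bullet>\<close> is multiplication) and vector fields.\<close>

definition L2_ip :: "(real^2) set \<Rightarrow> (real^2 \<Rightarrow> 'b::real_inner) \<Rightarrow> (real^2 \<Rightarrow> 'b) \<Rightarrow> real" where
  "L2_ip S u v = (LINT x:S|lebesgue. u x \<bullet> v x)"

text \<open>The length \<open>|e|\<close> of a segment is its diameter. The edge integral with respect to arc length
  does not depend on the choice of the order of the endpoints.\<close>

definition edge_integral :: "(real^2) set \<Rightarrow> (real^2 \<Rightarrow> real) \<Rightarrow> real" where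
  "edge_integral e f =
     (let (a, b) = (SOME (a, b). e = closed_segment a b)
      in dist a b * (LINT t:{0..1}|lebesgue. f (linepath a b t)))"

text \<open>Gradient and Hessian of the restriction of \<open>v\<close> to \<open>S\<close>. For a triangle \<open>S = K\<close> this gives
  one-sided derivatives on the edges. For \<open>S = \<Omega>\<close> open, the classical gradient of a continuous
  piecewise polynomial is defined off the edges, that is almost everywhere, and equals the weak
  gradient there.\<close>

definition grad :: "(real^2) set \<Rightarrow> (real^2 \<Rightarrow> real) \<Rightarrow> real^2 \<Rightarrow> real^2" where
  "grad S v x = (\<chi> i. frechet_derivative v (at x within S) (axis i 1))"

definition hess :: "(real^2) set \<Rightarrow> (real^2 \<Rightarrow> real) \<Rightarrow> real^2 \<Rightarrow> real^2^2" where
  "hess S v x = jacobian (grad S v) (at x within S)"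


section \<open>Finite element spaces\<close>

definition poly_space :: "nat \<Rightarrow> (real^2 \<Rightarrow> real) set" where
  "poly_space k =
     {p. \<exists>c. p = (\<lambda>x. \<Sum>(i, j) | i + j \<le> k. c i j * (x $ 1) ^ i * (x $ 2) ^ j)}"

text \<open>Functions on the closure of \<open>\<Omega>\<close> are represented by extensional functions, so that equality
  of elements means equality on the closure.\<close>

definition FE_space :: "nat \<Rightarrow> (real^2) set \<Rightarrow> (real^2) set set \<Rightarrow> (real^2 \<Rightarrow> real) set" where
  "FE_space k \<Omega> \<T> =
     {v \<in> extensional (closure \<Omega>). continuous_on (closure \<Omega>) v \<and>
        (\<forall>K\<in>\<T>. \<exists>p\<in>poly_space k. \<forall>x\<in>K. v x = p x)}"

definition Vh :: "(real^2) set \<Rightarrow> (real^2) set set \<Rightarrow> (real^2 \<Rightarrow> real) set" where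
  "Vh \<Omega> \<T> = FE_space 1 \<Omega> \<T>"

definition Zh :: "(real^2) set \<Rightarrow> (real^2) set set \<Rightarrow> (real^2 \<Rightarrow> real) set" where
  "Zh \<Omega> \<T> = FE_space 2 \<Omega> \<T>"

definition L20 :: "(real^2) set \<Rightarrow> (real^2 \<Rightarrow> real) set" where
  "L20 \<Omega> = {v. set_borel_measurable lebesgue \<Omega> v \<and> set_integrable lebesgue \<Omega> (\<lambda>x. (v x)\<^sup>2) \<and>
                L2_ip \<Omega> v (\<lambda>x. 1) = 0}"

definition Vh0 :: "(real^2) set \<Rightarrow> (real^2) set set \<Rightarrow> (real^2 \<Rightarrow> real) set" where
  "Vh0 \<Omega> \<T> = Vh \<Omega> \<T> \<inter> L20 \<Omega>"

definition Zh0 :: "(real^2) set \<Rightarrow> (real^2) set set \<Rightarrow> (real^2 \<Rightarrow> real) set" where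
  "Zh0 \<Omega> \<T> = Zh \<Omega> \<T> \<inter> L20 \<Omega>"


section \<open>The interior penalty form\<close>

definition jump_dn :: "(real^2) set set \<Rightarrow> (real^2) set \<Rightarrow> (real^2 \<Rightarrow> real) \<Rightarrow> real^2 \<Rightarrow> real" where
  "jump_dn \<T> e v x =
     (if interior_edge \<T> e
      then (let (Km, Kp) = edge_pair \<T> e; n = outer_normal Km e
            in n \<bullet> (grad Kp v x - grad Km v x))
      else (let K = boundary_triangle \<T> e; n = outer_normal K e
            in - (n \<bullet> grad K v x)))"

definition avg_dnn :: "(real^2) set set \<Rightarrow> (real^2) set \<Rightarrow> (real^2 \<Rightarrow> real) \<Rightarrow> real^2 \<Rightarrow> real" where
  "avg_dnn \<T> e v x =
     (if interior_edge \<T> e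
      then (let (Km, Kp) = edge_pair \<T> e; n = outer_normal Km e
            in 1/2 * (n \<bullet> (hess Km v x *v n) + n \<bullet> (hess Kp v x *v n)))
      else (let K = boundary_triangle \<T> e; n = outer_normal K e
            in n \<bullet> (hess K v x *v n)))"

text \<open>The inner product of \<^typ>\<open>real^2^2\<close> is the Frobenius product of matrices.\<close>

definition a_IP :: "(real^2) set set \<Rightarrow> real \<Rightarrow> (real^2 \<Rightarrow> real) \<Rightarrow> (real^2 \<Rightarrow> real) \<Rightarrow> real" where
  "a_IP \<T> \<alpha> w v =
     (\<Sum>K\<in>\<T>. L2_ip K (hess K w) (hess K v))
   + (\<Sum>e\<in>edges \<T>. edge_integral e (\<lambda>x. avg_dnn \<T> e w x * jump_dn \<T> e v x))
   + (\<Sum>e\<in>edges \<T>. edge_integral e (\<lambda>x. avg_dnn \<T> e v x * jump_dn \<T> e w x))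
   + \<alpha> * (\<Sum>e\<in>edges \<T>. 1 / diameter e *
            edge_integral e (\<lambda>x. jump_dn \<T> e w x * jump_dn \<T> e v x))"

definition norm_2h :: "(real^2) set set \<Rightarrow> real \<Rightarrow> (real^2 \<Rightarrow> real) \<Rightarrow> real" where
  "norm_2h \<T> \<alpha> v =
     sqrt ((\<Sum>K\<in>\<T>. L2_ip K (hess K v) (hess K v))
         + (\<Sum>e\<in>edges \<T>. \<alpha> / diameter e * edge_integral e (\<lambda>x. (jump_dn \<T> e v x)\<^sup>2)))"


section \<open>The two problems\<close>

definition solutions_A ::
  "(real^2) set \<Rightarrow> (real^2) set set \<Rightarrow> real \<Rightarrow> real \<Rightarrow> real \<Rightarrow> real \<Rightarrow> (real^2 \<Rightarrow> real) \<Rightarrow>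
   ((real^2 \<Rightarrow> real) \<times> (real^2 \<Rightarrow> real)) set" where
  "solutions_A \<Omega> \<T> \<alpha> \<epsilon> \<tau> \<phi>bar \<phi>prev =
     {(\<phi>, \<mu>). \<phi> \<in> Zh0 \<Omega> \<T> \<and> \<mu> \<in> Vh0 \<Omega> \<T> \<and>
        (\<forall>\<psi>\<in>Zh0 \<Omega> \<T>.
           a_IP \<T> \<alpha> \<phi> \<psi> + L2_ip \<Omega> (\<lambda>x. (\<phi> x + \<phi>bar) ^ 3) \<psi>
           + (1 - \<epsilon>) * L2_ip \<Omega> (\<lambda>x. \<phi> x + \<phi>bar) \<psi> - L2_ip \<Omega> \<mu> \<psi>
           = 2 * L2_ip \<Omega> (grad \<Omega> \<phi>prev) (grad \<Omega> \<psi>)) \<and>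
        (\<forall>\<nu>\<in>Vh0 \<Omega> \<T>.
           L2_ip \<Omega> (grad \<Omega> \<mu>) (grad \<Omega> \<nu>) = - L2_ip \<Omega> (\<lambda>x. (\<phi> x - \<phi>prev x) / \<tau>) \<nu>)}"

definition solutions_B ::
  "(real^2) set \<Rightarrow> (real^2) set set \<Rightarrow> real \<Rightarrow> real \<Rightarrow> real \<Rightarrow> (real^2 \<Rightarrow> real) \<Rightarrow>
   ((real^2 \<Rightarrow> real) \<times> (real^2 \<Rightarrow> real)) set" where
  "solutions_B \<Omega> \<T> \<alpha> \<epsilon> \<tau> \<phi>prev =
     {(\<phi>, \<mu>). \<phi> \<in> Zh \<Omega> \<T> \<and> \<mu> \<in> Vh \<Omega> \<T> \<and>
        (\<forall>\<nu>\<in>Vh \<Omega> \<T>.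
           L2_ip \<Omega> (\<lambda>x. (\<phi> x - \<phi>prev x) / \<tau>) \<nu> + L2_ip \<Omega> (grad \<Omega> \<mu>) (grad \<Omega> \<nu>) = 0) \<and>
        (\<forall>\<psi>\<in>Zh \<Omega> \<T>.
           a_IP \<T> \<alpha> \<phi> \<psi> + L2_ip \<Omega> (\<lambda>x. (\<phi> x) ^ 3 + (1 - \<epsilon>) * \<phi> x) \<psi>
           - 2 * L2_ip \<Omega> (grad \<Omega> \<phi>prev) (grad \<Omega> \<psi>) - L2_ip \<Omega> \<mu> \<psi> = 0)}"

definition A_to_B ::
  "(real^2) set \<Rightarrow> real \<Rightarrow> real \<Rightarrow> (real^2 \<Rightarrow> real) \<times> (real^2 \<Rightarrow> real) \<Rightarrow>
   (real^2 \<Rightarrow> real) \<times> (real^2 \<Rightarrow> real)" where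
  "A_to_B \<Omega> \<epsilon> \<phi>bar = (\<lambda>(\<phi>, \<mu>).
     (\<lambda>x\<in>closure \<Omega>. \<phi> x + \<phi>bar,
      \<lambda>x\<in>closure \<Omega>. \<mu> x
         + 1 / measure lebesgue \<Omega> * L2_ip \<Omega> (\<lambda>x. (\<phi> x + \<phi>bar) ^ 3) (\<lambda>x. 1)
         + (1 - \<epsilon>) * \<phi>bar))"

end

theory Submission
  imports Defs
begin

text \<open>The two problems differ by constants. Constants are in the kernel of the interior penalty form and of
  \<open>(\<nabla>\<cdot>, \<nabla>\<cdot>)\<close>. Testing Problem (B) with the constant 1 therefore fixes the means of \<open>\<phi>\<close> and \<open>\<mu>\<close>, and
  for functions with these means a constant in a test function contributes nothing. Every test function is
  the sum of one with mean zero and a constant, so (B) reduces to (A) (lemmas \<open>residual_shift\<close>,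
  \<open>mass_residual_shift\<close>, \<open>A_to_B_surj\<close>).

  Existence for (A) is a minimisation in finite dimension. On the affine elements of mean zero
  \<open>(\<nabla>\<cdot>, \<nabla>\<cdot>)\<close> is an inner product, because a function with zero gradient is constant on the connected
  domain (\<open>stiff_definite\<close>). Hence the second equation determines \<open>\<mu>\<close> linearly from \<open>\<phi>\<close>. What remains for
  \<open>\<phi>\<close> is an equation with a symmetric positive definite form and a monotone cubic term. In coordinates
  orthonormal for that form (\<open>orthonormal_spanning_family\<close>) it is the critical point equation of a
  continuous function bounded below by a coercive quadratic one (\<open>cubic_system_solvable\<close>). The positive
  definiteness comes from \<open>1 - \<epsilon> > 0\<close> together with the nonnegativity of the interior penalty form, which
  is a consequence of coercivity. Uniqueness is the monotonicity of the cube (\<open>weak_solution_unique\<close>).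

  For all this the forms must be linear on piecewise quadratic functions. One-sided derivatives on a
  triangle are those of the polynomial (\<open>grad_hess_quadratic\<close>), and the gradient on the domain agrees with
  them off the null set formed by the edges.\<close>

section \<open>Orthonormal families of functions\<close>

definition lincomb_closed :: "('x \<Rightarrow> real) set \<Rightarrow> bool" where
  "lincomb_closed V \<longleftrightarrow> (\<lambda>_. 0) \<in> V \<and> (\<forall>u\<in>V. \<forall>v\<in>V. \<forall>a b. (\<lambda>x. a * u x + b * v x) \<in> V)"

text \<open>Linearity is relative to a set of functions because the integrals and derivatives below are
  linear only on functions for which they exist.\<close>

definition functional_on :: "('x \<Rightarrow> real) set \<Rightarrow> (('x \<Rightarrow> real) \<Rightarrow> real) \<Rightarrow> bool" where
  "functional_on V L \<longleftrightarrow>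
     (\<forall>u\<in>V. \<forall>v\<in>V. \<forall>a b. L (\<lambda>x. a * u x + b * v x) = a * L u + b * L v)"

definition sym_bilinear_on ::
  "('x \<Rightarrow> real) set \<Rightarrow> (('x \<Rightarrow> real) \<Rightarrow> ('x \<Rightarrow> real) \<Rightarrow> real) \<Rightarrow> bool" where
  "sym_bilinear_on V A \<longleftrightarrow>
     (\<forall>w\<in>V. functional_on V (\<lambda>u. A u w)) \<and> (\<forall>u\<in>V. \<forall>v\<in>V. A u v = A v u)"

lemma lincomb_closedD:
  assumes "lincomb_closed V" "u \<in> V" "v \<in> V"
  shows "(\<lambda>x. a * u x + b * v x) \<in> V"
  using assms by (auto simp: lincomb_closed_def)

lemma functional_onD:
  assumes "functional_on V L" "u \<in> V" "v \<in> V"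
  shows "L (\<lambda>x. a * u x + b * v x) = a * L u + b * L v"
  using assms by (auto simp: functional_on_def)

lemma lincomb_closed_sum:
  fixes n :: nat
  assumes V: "lincomb_closed V" and e: "\<And>i. i < n \<Longrightarrow> e i \<in> V"
  shows "(\<lambda>x. \<Sum>i<n. c i * e i x) \<in> V"
  using e
proof (induction n)
  case 0
  then show ?case using V by (simp add: lincomb_closed_def)
next
  case (Suc n)
  have "(\<lambda>x. 1 * (\<Sum>i<n. c i * e i x) + c n * e n x) \<in> V"
    using Suc by (intro lincomb_closedD[OF V]) auto
  then show ?case by simp
qed

lemma functional_on_sum:
  fixes n :: nat
  assumes V: "lincomb_closed V" and L: "functional_on V L" and e: "\<And>i. i < n \<Longrightarrow> e i \<in> V"
  shows "L (\<lambda>x. \<Sum>i<n. c i * e i x) = (\<Sum>i<n. c i * L (e i))"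
  using e
proof (induction n)
  case 0
  have 0: "(\<lambda>_. 0) \<in> V" using V by (simp add: lincomb_closed_def)
  show ?case using functional_onD[OF L 0 0, of 0 0] by simp
next
  case (Suc n)
  have "L (\<lambda>x. 1 * (\<Sum>i<n. c i * e i x) + c n * e n x)
      = 1 * L (\<lambda>x. \<Sum>i<n. c i * e i x) + c n * L (e n)"
    using Suc by (intro functional_onD[OF L] lincomb_closed_sum[OF V]) auto
  then show ?case using Suc by simp
qed

lemma functional_on_subset: "functional_on V L \<Longrightarrow> W \<subseteq> V \<Longrightarrow> functional_on W L"
  by (auto simp: functional_on_def subset_iff)

lemma sym_bilinear_on_subset: "sym_bilinear_on V A \<Longrightarrow> W \<subseteq> V \<Longrightarrow> sym_bilinear_on W A"
  unfolding sym_bilinear_on_def by (meson functional_on_subset in_mono)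

text \<open>The functions on a triangulation that are polynomial on each triangle form a finite-dimensional
  space because each of them is determined by its values at finitely many points \<open>P\<close>. The proof is
  Gram--Schmidt by induction on \<open>P\<close>: the functions that vanish at the new point \<open>p\<close> have an
  orthonormal family by induction, and at most one further direction is missing, since every
  function differs by one vanishing at \<open>p\<close> from a multiple of a fixed \<open>w\<close> with \<open>w p \<noteq> 0\<close>.
  Functions are identified when they agree on \<open>C\<close>.\<close>

lemma orthonormal_spanning_family:
  assumes "finite P" "P \<subseteq> C" "lincomb_closed V" "sym_bilinear_on V A"
    and "\<And>v. v \<in> V \<Longrightarrow> \<exists>x\<in>C. v x \<noteq> 0 \<Longrightarrow> A v v > 0"
    and "\<And>v. v \<in> V \<Longrightarrow> \<forall>p\<in>P. v p = 0 \<Longrightarrow> \<forall>x\<in>C. v x = 0"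
  obtains n :: nat and e where "\<And>i. i < n \<Longrightarrow> e i \<in> V"
    and "\<And>i j. i < n \<Longrightarrow> j < n \<Longrightarrow> A (e i) (e j) = (if i = j then 1 else 0)"
    and "\<And>v. v \<in> V \<Longrightarrow> \<exists>c. \<forall>x\<in>C. v x = (\<Sum>i<n. c i * e i x)"
proof -
  have "\<exists>(n::nat) e. (\<forall>i<n. e i \<in> V) \<and> (\<forall>i<n. \<forall>j<n. A (e i) (e j) = (if i = j then 1 else 0)) \<and>
     (\<forall>v\<in>V. \<exists>c. \<forall>x\<in>C. v x = (\<Sum>i<n. c i * e i x))"
    using assms
  proof (induction P arbitrary: V rule: finite_induct)
    case empty
    show ?case
      by (rule exI[of _ "0::nat"], simp) (use empty.prems(5) in blast)
  next
    case (insert p P)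
    note V = insert.prems(2) and A = insert.prems(3)
    define V' where "V' = {v\<in>V. v p = 0}"
    have sub: "V' \<subseteq> V" by (auto simp: V'_def)
    have V': "lincomb_closed V'"
      using V by (auto simp: V'_def lincomb_closed_def)
    have "\<exists>(n::nat) e. (\<forall>i<n. e i \<in> V') \<and> (\<forall>i<n. \<forall>j<n. A (e i) (e j) = (if i = j then 1 else 0)) \<and>
     (\<forall>v\<in>V'. \<exists>c. \<forall>x\<in>C. v x = (\<Sum>i<n. c i * e i x))"
    proof (rule insert.IH[OF _ V' sym_bilinear_on_subset[OF A sub]])
      show "P \<subseteq> C" using insert.prems(1) by simp
      show "A v v > 0" if "v \<in> V'" "\<exists>x\<in>C. v x \<noteq> 0" for v
        using that sub by (intro insert.prems(4)) auto
      show "\<forall>x\<in>C. v x = 0" if "v \<in> V'" "\<forall>p\<in>P. v p = 0" for v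
        using that by (intro insert.prems(5)) (auto simp: V'_def)
    qed
    then obtain n :: nat and e where eV': "\<And>i. i < n \<Longrightarrow> e i \<in> V'"
      and on: "\<And>i j. i < n \<Longrightarrow> j < n \<Longrightarrow> A (e i) (e j) = (if i = j then 1 else 0)"
      and span: "\<And>v. v \<in> V' \<Longrightarrow> \<exists>c. \<forall>x\<in>C. v x = (\<Sum>i<n. c i * e i x)" by blast
    show ?case
    proof (cases "V' = V")
      case True
      then show ?thesis using eV' on span by blast
    next
      case False
      then obtain w where w: "w \<in> V" "w p \<noteq> 0" by (auto simp: V'_def)
      have eV: "e i \<in> V" "e i p = 0" if "i < n" for i using eV'[OF that] by (auto simp: V'_def)
      \<comment> \<open>The orthogonal projection of \<open>w\<close> is removed; the value at \<open>p\<close> stays, so the remainder is nonzero.\<close>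
      define w' where "w' = (\<lambda>x. 1 * w x + (-1) * (\<Sum>i<n. A w (e i) * e i x))"
      have w'V: "w' \<in> V" unfolding w'_def
        using w eV by (intro lincomb_closedD[OF V] lincomb_closed_sum[OF V])
      have w'p: "w' p = w p" unfolding w'_def using eV by simp
      have Aw': "A w' (e j) = 0" if j: "j < n" for j
      proof -
        have fn: "functional_on V (\<lambda>u. A u (e j))" using A eV(1)[OF j] by (auto simp: sym_bilinear_on_def)
        have "A w' (e j) = 1 * A w (e j) + (-1) * A (\<lambda>x. \<Sum>i<n. A w (e i) * e i x) (e j)"
          unfolding w'_def using w eV
          by (intro functional_onD[OF fn] lincomb_closed_sum[OF V])
        also have "A (\<lambda>x. \<Sum>i<n. A w (e i) * e i x) (e j) = (\<Sum>i<n. A w (e i) * A (e i) (e j))"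
          using functional_on_sum[OF V fn, of n e] eV by simp
        also have "\<dots> = (\<Sum>i<n. if i = j then A w (e i) else 0)"
          using on j by (intro sum.cong) auto
        also have "\<dots> = A w (e j)" using j by simp
        finally show ?thesis by simp
      qed
      have pos: "A w' w' > 0"
        using insert.prems(1) w'p w(2) by (intro insert.prems(4) w'V bexI[of _ p]) auto
      define s where "s = sqrt (A w' w')"
      have s: "s > 0" "s * s = A w' w'" using pos by (auto simp: s_def)
      define z where "z = (\<lambda>x. (1/s) * w' x + 0 * w' x)"
      have zV: "z \<in> V" unfolding z_def by (intro lincomb_closedD[OF V] w'V)
      have Az: "A z u = A w' u / s" if "u \<in> V" for u
        using functional_onD[of V "\<lambda>v. A v u" w' w' "1/s" 0] A that w'V
        by (simp add: z_def sym_bilinear_on_def)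
      have sym: "A u v = A v u" if "u \<in> V" "v \<in> V" for u v
        using A that by (auto simp: sym_bilinear_on_def)
      have Azz: "A z z = 1" using pos Az[OF zV] sym[OF w'V zV] Az[OF w'V] s by (simp add: field_simps)
      have Aze: "A z (e j) = 0" "A (e j) z = 0" if "j < n" for j
        using Az[OF eV(1)[OF that]] sym[OF zV eV(1)[OF that]] Aw'[OF that] by auto
      define e' where "e' = e(n := z)"
      show ?thesis
      proof (intro exI[of _ "Suc n"] exI[of _ e'] conjI allI impI ballI)
        show "e' i \<in> V" if "i < Suc n" for i using that zV eV by (auto simp: e'_def)
        show "A (e' i) (e' j) = (if i = j then 1 else 0)" if "i < Suc n" "j < Suc n" for i j
          using that Azz Aze on by (auto simp: e'_def less_Suc_eq)
        show "\<exists>c. \<forall>x\<in>C. v x = (\<Sum>i<Suc n. c i * e' i x)" if v: "v \<in> V" for v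
        proof -
          have zp: "z p \<noteq> 0" using s w'p w(2) by (simp add: z_def)
          define t where "t = v p / z p"
          have "(\<lambda>x. 1 * v x + (-t) * z x) \<in> V"
            by (intro lincomb_closedD[OF V] v zV)
          then have "(\<lambda>x. 1 * v x + (-t) * z x) \<in> V'" using zp by (simp add: V'_def t_def)
          from span[OF this] obtain c where c: "\<forall>x\<in>C. v x - t * z x = (\<Sum>i<n. c i * e i x)" by auto
          have "\<forall>x\<in>C. v x = (\<Sum>i<Suc n. (c(n:=t)) i * e' i x)"
          proof
            fix x assume "x \<in> C"
            have "(\<Sum>i<n. (c(n:=t)) i * e' i x) = (\<Sum>i<n. c i * e i x)"
              by (intro sum.cong) (auto simp: e'_def)
            then show "v x = (\<Sum>i<Suc n. (c(n:=t)) i * e' i x)"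
              using c \<open>x \<in> C\<close> by (simp add: e'_def) (metis diff_add_cancel)
          qed
          then show ?thesis by blast
        qed
      qed
    qed
  qed
  then show ?thesis using that by blast
qed

section \<open>A cubic system in finitely many unknowns\<close>

lemma set_integrable_continuous_on_compact:
  fixes f :: "'a::euclidean_space \<Rightarrow> real"
  assumes "compact C" "\<Omega> \<subseteq> C" "\<Omega> \<in> sets lebesgue" "continuous_on C f"
  shows "set_integrable lebesgue \<Omega> f"
proof -
  have "set_integrable lebesgue C f"
    using borel_integrable_compact[OF assms(1,4)]
    by (simp add: set_integrable_def integrable_completion)
  then show ?thesis using assms(3,2) by (rule set_integrable_subset)
qed

lemma set_integral_sum_finite:
  fixes f :: "'i \<Rightarrow> 'a \<Rightarrow> real"
  assumes "\<And>i. i \<in> I \<Longrightarrow> set_integrable M A (f i)"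
  shows "(LINT x:A|M. (\<Sum>i\<in>I. f i x)) = (\<Sum>i\<in>I. LINT x:A|M. f i x)"
  using assms unfolding set_lebesgue_integral_def set_integrable_def
  by (simp add: scaleR_sum_right sum_distrib_left Bochner_Integration.integral_sum)

text \<open>The integral is a polynomial in the coordinates \<open>c\<close>. The extra factor \<open>g\<close> makes the induction on
  the exponent work: one factor of the power is multiplied out and its basis functions are moved
  into \<open>g\<close>, which leaves a sum of coordinates times integrals with a smaller exponent.\<close>

lemma continuous_on_integral_power:
  fixes e :: "nat \<Rightarrow> 'a::euclidean_space \<Rightarrow> real"
  assumes C: "compact C" "\<Omega> \<subseteq> C" "\<Omega> \<in> sets lebesgue"
    and e: "\<And>i. i < n \<Longrightarrow> continuous_on C (e i)" and g: "continuous_on C g"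
  shows "continuous_on UNIV (\<lambda>c :: nat \<Rightarrow> real.
           LINT x:\<Omega>|lebesgue. g x * ((\<Sum>i<n. c i * e i x) + b) ^ k)"
  using g
proof (induction k arbitrary: g)
  case 0
  then show ?case by simp
next
  case (Suc k)
  note int = set_integrable_continuous_on_compact[OF C]
  have eq: "(LINT x:\<Omega>|lebesgue. g x * ((\<Sum>i<n. c i * e i x) + b) ^ Suc k)
    = (\<Sum>i<n. c i * (LINT x:\<Omega>|lebesgue. (g x * e i x) * ((\<Sum>i<n. c i * e i x) + b) ^ k))
      + b * (LINT x:\<Omega>|lebesgue. g x * ((\<Sum>i<n. c i * e i x) + b) ^ k)" for c
  proof -
    let ?q = "\<lambda>x. (\<Sum>i<n. c i * e i x) + b"
    have q: "continuous_on C ?q" using e by (intro continuous_intros) auto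
    have "(LINT x:\<Omega>|lebesgue. g x * ?q x ^ Suc k)
      = (LINT x:\<Omega>|lebesgue. (\<Sum>i<n. c i * ((g x * e i x) * ?q x ^ k)) + b * (g x * ?q x ^ k))"
      by (rule arg_cong[where f = "set_lebesgue_integral lebesgue \<Omega>"])
         (auto simp: algebra_simps sum_distrib_left sum_distrib_right)
    also have "\<dots> = (LINT x:\<Omega>|lebesgue. (\<Sum>i<n. c i * ((g x * e i x) * ?q x ^ k)))
       + (LINT x:\<Omega>|lebesgue. b * (g x * ?q x ^ k))"
      using e q Suc.prems by (intro set_integral_add int continuous_intros) auto
    also have "(LINT x:\<Omega>|lebesgue. (\<Sum>i<n. c i * ((g x * e i x) * ?q x ^ k)))
      = (\<Sum>i<n. LINT x:\<Omega>|lebesgue. c i * ((g x * e i x) * ?q x ^ k))"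
      using e q Suc.prems
      by (intro set_integral_sum_finite int continuous_intros) auto
    finally show ?thesis by simp
  qed
  show ?case unfolding eq
    using Suc.prems e
    by (intro continuous_intros continuous_on_product_coordinates Suc.IH) auto
qed

text \<open>The equations say that \<open>c\<close> is a critical point of
  \<open>J c = (\<Sum>i. c\<^sub>i\<^sup>2 / 2 - l\<^sub>i c\<^sub>i) + 1/4 \<integral> (\<Sum>i. c\<^sub>i e\<^sub>i + b)\<^sup>4\<close>. The quartic term is
  nonnegative, so \<open>J\<close> grows quadratically and attains its minimum over all coordinate vectors
  already on a box. Vectors of length \<open>n\<close> are sequences that vanish from \<open>n\<close> on; the box is then a
  product of compact sets.\<close>

lemma cubic_system_solvable:
  fixes e :: "nat \<Rightarrow> 'a::euclidean_space \<Rightarrow> real" and l :: "nat \<Rightarrow> real"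
  assumes C: "compact C" "\<Omega> \<subseteq> C" "\<Omega> \<in> sets lebesgue"
    and e: "\<And>i. i < n \<Longrightarrow> continuous_on C (e i)"
  obtains c :: "nat \<Rightarrow> real" where
    "\<And>i. i < n \<Longrightarrow> c i + (LINT x:\<Omega>|lebesgue. ((\<Sum>i<n. c i * e i x) + b) ^ 3 * e i x) = l i"
proof -
  note int = set_integrable_continuous_on_compact[OF C]
  define q where "q = (\<lambda>(c::nat \<Rightarrow> real) x. (\<Sum>i<n. c i * e i x) + b)"
  have qc: "continuous_on C (q c)" for c unfolding q_def using e by (intro continuous_intros) auto
  define J where "J = (\<lambda>c. (\<Sum>i<n. (c i)\<^sup>2 / 2 - l i * c i) + (LINT x:\<Omega>|lebesgue. 1/4 * q c x ^ 4))"
  have Jc: "continuous_on S J" for S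
    unfolding J_def q_def
    by (rule continuous_on_subset[of UNIV])
       (intro continuous_intros continuous_on_product_coordinates
          continuous_on_integral_power[OF C e], auto)
  have Q0: "0 \<le> (LINT x:\<Omega>|lebesgue. 1/4 * q c x ^ 4)" for c
    unfolding set_lebesgue_integral_def by (intro integral_nonneg_AE) auto
  \<comment> \<open>Outside the box some coordinate exceeds \<open>2 R\<close> in absolute value, and \<open>lb\<close> gives \<open>J d > R\<^sup>2 - (\<Sum>i. l\<^sub>i\<^sup>2) \<ge> J 0\<close>; the summand 1 in \<open>R\<close> serves \<open>M \<le> R\<^sup>2\<close>.\<close>
  define M where "M = \<bar>J (\<lambda>_. 0)\<bar> + (\<Sum>i<n. (l i)\<^sup>2)"
  have M0: "M \<ge> 0" unfolding M_def by (intro add_nonneg_nonneg sum_nonneg) auto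
  define R where "R = M + 1"
  define B where "B = (\<Pi>\<^sub>E i\<in>(UNIV::nat set). if i < n then {- 2 * R..2 * R} else {0::real})"
  have lb: "J c \<ge> (c i)\<^sup>2 / 4 - (\<Sum>i<n. (l i)\<^sup>2)" if "i < n" for c i
  proof -
    have "(c i)\<^sup>2 / 4 - (\<Sum>i<n. (l i)\<^sup>2) \<le> (\<Sum>i<n. (c i)\<^sup>2 / 4) - (\<Sum>i<n. (l i)\<^sup>2)"
      using that member_le_sum[of i "{..<n}" "\<lambda>i. (c i)\<^sup>2 / 4"] by simp
    also have "\<dots> = (\<Sum>i<n. (c i)\<^sup>2 / 4 - (l i)\<^sup>2)" by (simp add: sum_subtractf)
    also have "\<dots> \<le> (\<Sum>i<n. (c i)\<^sup>2 / 2 - l i * c i)"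
    proof (intro sum_mono)
      fix i
      have "0 \<le> (c i / 2 - l i)\<^sup>2" by simp
      then show "(c i)\<^sup>2 / 4 - (l i)\<^sup>2 \<le> (c i)\<^sup>2 / 2 - l i * c i"
        by (simp add: power2_eq_square algebra_simps)
    qed
    also have "\<dots> \<le> J c" using Q0[of c] by (simp add: J_def)
    finally show ?thesis .
  qed
  have "compact B"
    using compactin_PiE[of "\<lambda>_::nat. euclidean :: real topology" UNIV]
    unfolding B_def by (simp add: euclidean_product_topology)
  moreover have 0: "(\<lambda>_. 0) \<in> B" using M0 by (auto simp: B_def R_def)
  ultimately obtain c where c: "c \<in> B" "\<And>d. d \<in> B \<Longrightarrow> J c \<le> J d"
    using continuous_attains_inf[OF _ _ Jc, of B] by blast
  have glob: "J c \<le> J d" if d: "\<And>i. i \<ge> n \<Longrightarrow> d i = 0" for d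
  proof (cases "d \<in> B")
    case False
    then obtain i where i: "i < n" "\<bar>d i\<bar> > 2 * R" using d by (fastforce simp: B_def)
    have "(2 * R)\<^sup>2 < \<bar>d i\<bar>\<^sup>2" using i M0 by (intro power_strict_mono) (auto simp: R_def)
    then have "R\<^sup>2 < (d i)\<^sup>2 / 4" by (simp add: power_mult_distrib)
    moreover have "M \<le> R\<^sup>2" using M0 by (auto simp: R_def power2_eq_square algebra_simps)
    ultimately have "J (\<lambda>_. 0) \<le> J d" using lb[OF i(1), of d] by (simp add: M_def)
    with c(2)[OF 0] show ?thesis by simp
  qed (use c in auto)
  have "c i + (LINT x:\<Omega>|lebesgue. q c x ^ 3 * e i x) = l i" if i: "i < n" for i
  proof -
    define d where "d = (\<lambda>t. c(i := c i + t))"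
    have qd: "q (d t) x = q c x + t * e i x" for t x
    proof -
      have "(\<Sum>j<n. d t j * e j x) = (\<Sum>j<n. c j * e j x + (if j = i then t * e i x else 0))"
        by (intro sum.cong) (auto simp: d_def algebra_simps)
      then show ?thesis using i by (simp add: q_def sum.distrib)
    qed
    let ?m = "\<lambda>j. LINT x:\<Omega>|lebesgue. q c x ^ (4 - j) * e i x ^ j"
    have m: "set_integrable lebesgue \<Omega> (\<lambda>x. k * (q c x ^ r * e i x ^ j))" for k r j
      using e[OF i] qc by (intro int continuous_intros) auto
    \<comment> \<open>Along a coordinate direction \<open>J\<close> is a polynomial in \<open>t\<close>, so no differentiation under the integral sign is involved.\<close>
    have I: "(LINT x:\<Omega>|lebesgue. 1/4 * q (d t) x ^ 4)
       = 1/4 * ?m 0 + t * ?m 1 + 3/2 * t^2 * ?m 2 + t^3 * ?m 3 + t^4 / 4 * ?m 4" for t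
    proof -
      have "(LINT x:\<Omega>|lebesgue. 1/4 * q (d t) x ^ 4)
        = (LINT x:\<Omega>|lebesgue. (((1/4 * (q c x ^ (4-0) * e i x ^ 0) + t * (q c x ^ (4-1) * e i x ^ 1))
           + 3/2 * t^2 * (q c x ^ (4-2) * e i x ^ 2)) + t^3 * (q c x ^ (4-3) * e i x ^ 3))
           + t^4/4 * (q c x ^ (4-4) * e i x ^ 4))"
        unfolding qd by (rule arg_cong[where f = "set_lebesgue_integral lebesgue \<Omega>"])
          (auto simp: fun_eq_iff algebra_simps power4_eq_xxxx power3_eq_cube power2_eq_square)
      also have "\<dots> = 1/4 * ?m 0 + t * ?m 1 + 3/2 * t^2 * ?m 2 + t^3 * ?m 3 + t^4 / 4 * ?m 4"
        by (subst set_integral_add(2), intro set_integral_add m, rule m)+ simp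
      finally show ?thesis .
    qed
    have S: "(\<Sum>j<n. (d t j)\<^sup>2 / 2 - l j * d t j)
        = (\<Sum>j<n. (c j)\<^sup>2 / 2 - l j * c j) + t * (c i - l i) + t\<^sup>2 / 2" for t
    proof -
      have "(\<Sum>j<n. (d t j)\<^sup>2 / 2 - l j * d t j)
          = (\<Sum>j<n. ((c j)\<^sup>2 / 2 - l j * c j) + (if j = i then t * (c i - l i) + t\<^sup>2 / 2 else 0))"
        by (intro sum.cong) (auto simp: d_def algebra_simps power2_eq_square add_divide_distrib)
      then show ?thesis using i by (simp add: sum.distrib)
    qed
    define f where "f = (\<lambda>t::real. t * (c i - l i) + t\<^sup>2 / 2
        + (t * ?m 1 + 3/2 * t^2 * ?m 2 + t^3 * ?m 3 + t^4 / 4 * ?m 4))"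
    have Jd: "J (d t) = J (d 0) + f t" for t
      unfolding J_def S I f_def by simp
    have "d 0 = c" by (simp add: d_def)
    have f0: "f 0 \<le> f t" for t
    proof -
      have "c j = 0" if "j \<ge> n" for j
        using PiE_mem[OF c(1)[unfolded B_def], of j] that by simp
      then have "J c \<le> J (d t)" using i by (intro glob) (auto simp: d_def)
      then show ?thesis using Jd[of t] Jd[of 0] \<open>d 0 = c\<close> by simp
    qed
    have "(f has_real_derivative ((c i - l i) + ?m 1)) (at 0)"
      unfolding f_def by (auto intro!: derivative_eq_intros)
    from DERIV_local_min[OF this, of 1] f0 have "(c i - l i) + ?m 1 = 0" by auto
    then show ?thesis by simp
  qed
  then show ?thesis using that[of c] by (auto simp: q_def)
qed

section \<open>Quadratic polynomials on a triangle\<close>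

text \<open>At a vertex of a triangle the coordinate directions may all leave the triangle, so uniqueness of
  the derivative is not a matter of partial derivatives. Instead, two derivatives agree on \<open>y - x\<close>
  for every \<open>y\<close> in \<open>K\<close>, by restriction to the segment from \<open>x\<close> to \<open>y\<close>, and these vectors span the
  space since \<open>K\<close> contains a ball.\<close>

lemma has_derivative_within_convex_unique:
  fixes f :: "'a::euclidean_space \<Rightarrow> 'b::real_normed_vector"
  assumes K: "convex K" "interior K \<noteq> {}" and x: "x \<in> K"
    and f: "(f has_derivative f') (at x within K)" "(f has_derivative f'') (at x within K)"
  shows "f' = f''"
proof -
  define D where "D = (\<lambda>h. f' h - f'' h)"
  have D: "((\<lambda>_. 0 :: 'b) has_derivative D) (at x within K)"
    using has_derivative_diff[OF f] by (simp add: D_def)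
  have lin: "linear D" using D by (rule has_derivative_linear)
  have D0: "D (y - x) = 0" if y: "y \<in> K" for y
  proof -
    define g where "g = (\<lambda>t::real. x + t *\<^sub>R (y - x))"
    have img: "g ` {0..1} \<subseteq> K"
    proof
      fix z assume "z \<in> g ` {0..1}"
      then obtain t where t: "0 \<le> t" "t \<le> 1" "z = (1 - t) *\<^sub>R x + t *\<^sub>R y"
        by (auto simp: g_def algebra_simps)
      then show "z \<in> K" using K(1) x y by (auto simp: convex_alt)
    qed
    have g: "(g has_derivative (\<lambda>t. t *\<^sub>R (y - x))) (at 0 within {0..1})"
      unfolding g_def by (auto intro!: derivative_eq_intros)
    have "((\<lambda>_. 0) \<circ> g has_derivative D \<circ> (\<lambda>t. t *\<^sub>R (y - x))) (at 0 within {0..1})"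
      using g img D by (intro diff_chain_within has_derivative_subset[OF D]) (auto simp: g_def intro: has_derivative_subset)
    then have "((\<lambda>_. 0) has_vector_derivative D (y - x)) (at 0 within {0..1::real})"
      using lin by (simp add: has_vector_derivative_def o_def linear_scale)
    moreover have "((\<lambda>_. 0) has_vector_derivative 0) (at 0 within {0..1::real})" by simp
    ultimately show ?thesis
      using vector_derivative_unique_within_closed_interval[of 0 1 0 "\<lambda>_. 0 :: 'b"] by simp
  qed
  obtain z r where r: "r > 0" "ball z r \<subseteq> K"
    using K(2) by (metis all_not_in_conv mem_interior)
  have "D h = 0" for h
  proof (cases "h = 0")
    case False
    define s where "s = r / (2 * norm h)"
    have s: "s > 0" using r False by (simp add: s_def)
    have "z \<in> K" "z + s *\<^sub>R h \<in> K"
      using r False by (auto intro!: subsetD[OF r(2)] simp: s_def dist_norm)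
    then have "D (z + s *\<^sub>R h - x) - D (z - x) = 0" using D0 by simp
    then have "D (s *\<^sub>R h) = 0" using linear_diff[OF lin, symmetric] by simp
    then show ?thesis using s lin by (simp add: linear_scale)
  qed (use lin in \<open>simp add: linear_0\<close>)
  then show ?thesis by (auto simp: D_def fun_eq_iff)
qed

lemma poly_space_quadratic:
  "p \<in> poly_space 2 \<longleftrightarrow> (\<exists>c00 c10 c01 c20 c11 c02. p = (\<lambda>x. c00 + c10 * x $ 1 + c01 * x $ 2
      + c20 * (x $ 1)\<^sup>2 + c11 * x $ 1 * x $ 2 + c02 * (x $ 2)\<^sup>2))" (is "_ = ?R")
proof -
  have S: "{(i, j). i + j \<le> (2::nat)} = {(0,0),(1,0),(0,1),(2,0),(1,1),(0,2)}" by auto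
  have eq: "(\<Sum>(i, j) | i + j \<le> 2. c i j * (x $ 1) ^ i * (x $ 2) ^ j)
    = c 0 0 + c 1 0 * x $ 1 + c 0 1 * x $ 2
      + c 2 0 * (x $ 1)\<^sup>2 + c 1 1 * x $ 1 * x $ 2 + c 0 2 * (x $ 2)\<^sup>2"
    for c :: "nat \<Rightarrow> nat \<Rightarrow> real" and x :: "real^2"
    unfolding S by simp
  show ?thesis
  proof
    assume ?R
    then obtain c00 c10 c01 c20 c11 c02 where p: "p = (\<lambda>x. c00 + c10 * x $ 1 + c01 * x $ 2
      + c20 * (x $ 1)\<^sup>2 + c11 * x $ 1 * x $ 2 + c02 * (x $ 2)\<^sup>2)" by blast
    show "p \<in> poly_space 2" unfolding poly_space_def eq p
      by (rule CollectI, rule exI[of _ "\<lambda>i j. if i = 0 then if j = 0 then c00 else if j = 1 then c01 else c02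
            else if i = 1 then if j = 0 then c10 else c11 else c20"]) simp
  qed (unfold poly_space_def eq, blast)
qed

lemma poly_space_affine:
  assumes "p \<in> poly_space 1"
  shows "\<exists>a g. p = (\<lambda>x. a + g \<bullet> x)"
proof -
  have S: "{(i, j). i + j \<le> (1::nat)} = {(0,0),(1,0),(0,1)}" by auto
  from assms obtain c where p: "p = (\<lambda>x. \<Sum>(i, j) | i + j \<le> 1. c i j * (x $ 1) ^ i * (x $ 2) ^ j)"
    by (auto simp: poly_space_def)
  have "p = (\<lambda>x. c 0 0 + c 1 0 * x $ 1 + c 0 1 * x $ 2)" unfolding p S by (simp add: fun_eq_iff)
  also have "\<dots> = (\<lambda>x. c 0 0 + vector [c 1 0, c 0 1] \<bullet> x)" by (simp add: inner_vec_def sum_2 fun_eq_iff)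
  finally show ?thesis by blast
qed

lemma poly_space_const: "(\<lambda>_. a) \<in> poly_space k"
proof -
  have "a = (\<Sum>(i, j) | i + j \<le> k. (if i = 0 \<and> j = 0 then a else 0) * (x $ 1) ^ i * (x $ 2) ^ j)"
    for x :: "real^2"
  proof -
    have fin: "finite {(i, j). i + j \<le> k}"
      by (rule finite_subset[of _ "{..k} \<times> {..k}"]) auto
    have "(\<Sum>(i, j) | i + j \<le> k. (if i = 0 \<and> j = 0 then a else 0) * (x $ 1) ^ i * (x $ 2) ^ j)
      = (\<Sum>ij | fst ij + snd ij \<le> k. if ij = (0, 0) then a else 0)"
      by (intro sum.cong) (auto split: if_splits)
    also have "\<dots> = a" using fin by (simp add: case_prod_unfold)
    finally show ?thesis by simp
  qed
  then show ?thesis unfolding poly_space_def mem_Collect_eq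
    by (intro exI[of _ "\<lambda>i j. if i = 0 \<and> j = 0 then a else 0"] ext)
qed

lemma poly_space_lincomb:
  assumes "p \<in> poly_space k" "q \<in> poly_space k"
  shows "(\<lambda>x. a * p x + b * q x) \<in> poly_space k"
proof -
  from assms obtain c d where
    p: "p = (\<lambda>x. \<Sum>(i, j) | i + j \<le> k. c i j * (x $ 1) ^ i * (x $ 2) ^ j)" and
    q: "q = (\<lambda>x. \<Sum>(i, j) | i + j \<le> k. d i j * (x $ 1) ^ i * (x $ 2) ^ j)"
    by (auto simp: poly_space_def)
  show ?thesis unfolding poly_space_def
    by (rule CollectI, rule exI[of _ "\<lambda>i j. a * c i j + b * d i j"])
       (simp add: p q sum_distrib_left sum.distrib[symmetric] algebra_simps case_prod_unfold)
qed

lemma poly_space_mono: 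
  assumes "k \<le> l" shows "poly_space k \<subseteq> poly_space l"
proof
  fix p assume "p \<in> poly_space k"
  then obtain c where p: "p = (\<lambda>x. \<Sum>(i, j) | i + j \<le> k. c i j * (x $ 1) ^ i * (x $ 2) ^ j)"
    by (auto simp: poly_space_def)
  have fin: "finite {(i, j). i + j \<le> l}"
    by (rule finite_subset[of _ "{..l} \<times> {..l}"]) auto
  have "p = (\<lambda>x. \<Sum>(i, j) | i + j \<le> l. (if i + j \<le> k then c i j else 0) * (x $ 1) ^ i * (x $ 2) ^ j)"
    unfolding p by (intro ext sum.mono_neutral_cong_left fin) (use assms in \<open>auto split: if_splits\<close>)
  then show "p \<in> poly_space l" unfolding poly_space_def
    by (intro CollectI exI[of _ "\<lambda>i j. if i + j \<le> k then c i j else 0"])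
qed

lemma quadratic_form_of_poly_space:
  assumes "p \<in> poly_space 2"
  obtains a g H where "transpose H = H" "p = (\<lambda>x. a + g \<bullet> x + 1/2 * (x \<bullet> (H *v x)))"
proof -
  from assms obtain c00 c10 c01 c20 c11 c02 where p: "p = (\<lambda>x. c00 + c10 * x $ 1 + c01 * x $ 2
      + c20 * (x $ 1)\<^sup>2 + c11 * x $ 1 * x $ 2 + c02 * (x $ 2)\<^sup>2)" by (auto simp: poly_space_quadratic)
  define g :: "real^2" where "g = vector [c10, c01]"
  define H :: "real^2^2" where "H = vector [vector [2 * c20, c11], vector [c11, 2 * c02]]"
  have "transpose H = H" by (simp add: H_def transpose_def vec_eq_iff forall_2)
  moreover have "p = (\<lambda>x. c00 + g \<bullet> x + 1/2 * (x \<bullet> (H *v x)))"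
    by (simp add: p g_def H_def inner_vec_def matrix_vector_mult_def sum_2 fun_eq_iff
        algebra_simps power2_eq_square)
  ultimately show ?thesis using that by blast
qed

text \<open>Six points determine a quadratic polynomial of two variables. Points \<open>z\<close>, \<open>z \<plusminus> r e\<^sub>1\<close> and
  \<open>z \<plusminus> r e\<^sub>2\<close> give everything but the mixed coefficient, which the last point detects.\<close>

lemma quadratic_determining_points:
  fixes K :: "(real^2) set"
  assumes "interior K \<noteq> {}"
  obtains P where "finite P" "P \<subseteq> K" "\<And>p. p \<in> poly_space 2 \<Longrightarrow> \<forall>x\<in>P. p x = 0 \<Longrightarrow> p = (\<lambda>_. 0)"
proof -
  obtain z r where r: "r > 0" "cball z r \<subseteq> K"
    using assms by (metis all_not_in_conv mem_interior_cball)
  define pt :: "real \<Rightarrow> real \<Rightarrow> real^2" where "pt s t = z + vector [s, t]" for s t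
  define P where "P = {pt 0 0, pt r 0, pt (-r) 0, pt 0 r, pt 0 (-r), pt (r/2) (r/2)}"
  have inK: "pt s t \<in> K" if "\<bar>s\<bar> + \<bar>t\<bar> \<le> r" for s t
  proof -
    have "norm (vector [s, t] :: real^2) \<le> \<bar>s\<bar> + \<bar>t\<bar>"
      using norm_le_l1_cart[of "vector [s, t] :: real^2"] by (simp add: sum_2)
    then show ?thesis using that by (intro subsetD[OF r(2)]) (simp add: pt_def dist_norm)
  qed
  have "P \<subseteq> K" unfolding P_def using r(1) by (auto intro!: inK)
  moreover have "p = (\<lambda>_. 0)" if p: "p \<in> poly_space 2" "\<forall>x\<in>P. p x = 0" for p
  proof -
    from p(1) obtain c00 c10 c01 c20 c11 c02 where pe: "p = (\<lambda>x. c00 + c10 * x $ 1 + c01 * x $ 2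
      + c20 * (x $ 1)\<^sup>2 + c11 * x $ 1 * x $ 2 + c02 * (x $ 2)\<^sup>2)" by (auto simp: poly_space_quadratic)
    \<comment> \<open>The first-order coefficients of the Taylor expansion at \<open>z\<close>.\<close>
    define B where "B = c10 + 2 * c20 * z $ 1 + c11 * z $ 2"
    define C where "C = c01 + 2 * c02 * z $ 2 + c11 * z $ 1"
    have tay: "p (pt s t) = p z + B * s + C * t + c20 * s\<^sup>2 + c11 * s * t + c02 * t\<^sup>2" for s t
      by (simp add: pe pt_def B_def C_def algebra_simps power2_eq_square)
    have z0: "p (pt 0 0) = 0" "p (pt r 0) = 0" "p (pt (-r) 0) = 0" "p (pt 0 r) = 0"
      "p (pt 0 (-r)) = 0" "p (pt (r/2) (r/2)) = 0" using p(2) by (auto simp: P_def)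
    have a: "p z = 0" using z0(1) tay[of 0 0] by simp
    have "B * r = 0" "c20 * r\<^sup>2 = 0" using z0(2,3) tay[of r 0] tay[of "-r" 0] a by auto
    then have b: "B = 0" "c20 = 0" using r(1) by auto
    have "C * r = 0" "c02 * r\<^sup>2 = 0" using z0(4,5) tay[of 0 r] tay[of 0 "-r"] a by auto
    then have c: "C = 0" "c02 = 0" using r(1) by auto
    have "c11 * (r/2) * (r/2) = 0" using z0(6) tay[of "r/2" "r/2"] a b c by simp
    then have d: "c11 = 0" using r(1) by auto
    have "c10 = 0" "c01 = 0" using b c d by (auto simp: B_def C_def)
    then show ?thesis using a b c d by (simp add: pe)
  qed
  ultimately show ?thesis using that[of P] by (auto simp: P_def)
qed

text \<open>The one-sided gradient and Hessian on a triangle are those of the polynomial, on the edges and at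
  the vertices too. The Hessian is a derivative of the one-sided gradient, hence the need to know the
  gradient at all points of \<open>K\<close> first.\<close>

lemma grad_hess_quadratic:
  assumes K: "convex K" "interior K \<noteq> {}" and H: "transpose H = H"
    and v: "\<And>x. x \<in> K \<Longrightarrow> v x = a + g \<bullet> x + 1/2 * (x \<bullet> (H *v x))"
    and x: "x \<in> K"
  shows "grad K v x = g + H *v x" "hess K v x = H"
proof -
  have sym: "y \<bullet> (H *v h) = (H *v y) \<bullet> h" for y h
    using H by (metis dot_lmul_matrix transpose_matrix_vector)
  have dv: "(v has_derivative (\<lambda>h. (g + H *v y) \<bullet> h)) (at y within K)" if y: "y \<in> K" for y
  proof -
    have "((\<lambda>x. a + g \<bullet> x + 1/2 * (x \<bullet> (H *v x))) has_derivative (\<lambda>h. (g + H *v y) \<bullet> h)) (at y within K)"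
      by (rule derivative_eq_intros bounded_linear.has_derivative[OF matrix_vector_mul_bounded_linear] refl)+
         (simp add: fun_eq_iff sym inner_add_left, metis inner_commute sym)
    then show ?thesis by (rule has_derivative_transform[rotated -1]) (use y v in auto)
  qed
  have fd: "frechet_derivative f (at y within K) = f'"
    if "(f has_derivative f') (at y within K)" "y \<in> K" for f :: "real^2 \<Rightarrow> 'b::real_normed_vector" and f' y
    using that by (metis K differentiableI frechet_derivative_works has_derivative_within_convex_unique)
  have gr: "grad K v y = g + H *v y" if "y \<in> K" for y
    using fd[OF dv[OF that] that] by (simp add: grad_def vec_eq_iff inner_axis)
  show "grad K v x = g + H *v x" using gr x .
  have "((\<lambda>y. g + H *v y) has_derivative (\<lambda>h. H *v h)) (at x within K)"
    by (rule derivative_eq_intros bounded_linear.has_derivative[OF matrix_vector_mul_bounded_linear] refl)+ simp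
  then have "(grad K v has_derivative (\<lambda>h. H *v h)) (at x within K)"
    by (rule has_derivative_transform[rotated -1]) (use x gr in auto)
  from fd[OF this x] show "hess K v x = H"
    by (simp add: hess_def jacobian_def matrix_of_matrix_vector_mul)
qed

section \<open>Linearity of the integrals\<close>

lemma sum_lincomb:
  fixes F :: "'i \<Rightarrow> real"
  assumes "\<And>i. i \<in> I \<Longrightarrow> F i = a * G i + b * H i"
  shows "sum F I = a * sum G I + b * sum H I"
  using assms by (simp add: sum.distrib sum_distrib_left)

lemma L2_ip_lincomb:
  fixes f g h w :: "real^2 \<Rightarrow> 'b::real_inner"
  assumes "\<And>x. x \<in> S \<Longrightarrow> f x = a *\<^sub>R g x + b *\<^sub>R h x"
    and "set_integrable lebesgue S (\<lambda>x. g x \<bullet> w x)" "set_integrable lebesgue S (\<lambda>x. h x \<bullet> w x)"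
  shows "L2_ip S f w = a * L2_ip S g w + b * L2_ip S h w"
proof -
  have "L2_ip S f w = (LINT x:S|lebesgue. a * (g x \<bullet> w x) + b * (h x \<bullet> w x))"
    unfolding L2_ip_def set_lebesgue_integral_def using assms(1)
    by (intro Bochner_Integration.integral_cong refl) (auto simp: inner_add_left split: split_indicator)
  also have "\<dots> = (LINT x:S|lebesgue. a * (g x \<bullet> w x)) + (LINT x:S|lebesgue. b * (h x \<bullet> w x))"
    using assms(2,3) by (intro set_integral_add set_integrable_mult_right)
  finally show ?thesis unfolding L2_ip_def by simp
qed

lemma L2_ip_commute: "L2_ip S u v = L2_ip S v u"
  unfolding L2_ip_def by (simp only: inner_commute[of "u _" "v _"])

lemma edge_integral_lincomb:
  assumes e: "\<exists>a b. e = closed_segment a b"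
    and f: "\<And>x. x \<in> e \<Longrightarrow> f x = s * g x + t * h x"
    and g: "continuous_on e g" and h: "continuous_on e h"
  shows "edge_integral e f = s * edge_integral e g + t * edge_integral e h"
proof -
  obtain a b where ab: "(SOME (a, b). e = closed_segment a b) = (a, b)" "e = closed_segment a b"
  proof -
    have "case (SOME (a, b). e = closed_segment a b) of (a, b) \<Rightarrow> e = closed_segment a b"
      using e by (intro someI_ex[of "\<lambda>(a, b). e = closed_segment a b"]) auto
    then show ?thesis using that by (cases "SOME (a, b). e = closed_segment a b") simp
  qed
  have lp: "linepath a b u \<in> e" if "u \<in> {0..1}" for u
    using that ab(2) linepath_in_path by blast
  have c: "set_integrable lebesgue {0..1} (\<lambda>u. k (linepath a b u))" if "continuous_on e k" for k :: "real^2 \<Rightarrow> real"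
    using lp by (intro set_integrable_continuous_on_compact[of "{0..1}"]
        continuous_on_compose2[OF that continuous_on_linepath]) auto
  have cs: "set_integrable lebesgue {0..1} (\<lambda>u. r * k (linepath a b u))"
    if "continuous_on e k" for k :: "real^2 \<Rightarrow> real" and r
    using c[OF that] by (rule set_integrable_mult_right)
  have "(LINT u:{0..1}|lebesgue. f (linepath a b u))
     = (LINT u:{0..1}|lebesgue. s * g (linepath a b u) + t * h (linepath a b u))"
    by (intro set_lebesgue_integral_cong) (use f lp in auto)
  also have "\<dots> = s * (LINT u:{0..1}|lebesgue. g (linepath a b u))
      + t * (LINT u:{0..1}|lebesgue. h (linepath a b u))"
    by (simp only: set_integral_add(2)[OF cs[OF g] cs[OF h]] set_integral_mult_right)
  finally show ?thesis using ab(1) by (simp add: edge_integral_def algebra_simps)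
qed

lemma negligible_AE:
  assumes "AE x in lebesgue. x \<notin> N"
  shows "negligible N"
proof -
  obtain N' where "N' \<in> null_sets lebesgue" "N \<subseteq> N'"
    using assms by (auto simp: eventually_ae_filter)
  then show ?thesis using negligible_iff_null_sets negligible_subset by blast
qed

section \<open>Piecewise polynomials on a triangulated polygon\<close>

locale fe_mesh =
  fixes \<Omega> :: "(real^2) set" and \<T> :: "(real^2) set set"
  assumes domain: "polygonal_domain \<Omega>" and mesh: "triangulates \<T> \<Omega>"
begin

abbreviation "C \<equiv> closure \<Omega>"

text \<open>The elements of the finite element space without the convention on values outside the closure
  of the domain. Dropping it makes the space closed under pointwise sums; all forms below depend only
  on values on the closure.\<close>

definition PP :: "nat \<Rightarrow> (real^2 \<Rightarrow> real) set" where
  "PP k = {v. continuous_on C v \<and> (\<forall>K\<in>\<T>. \<exists>p\<in>poly_space k. \<forall>x\<in>K. v x = p x)}"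

lemma FE_space_eq: "FE_space k \<Omega> \<T> = PP k \<inter> extensional C"
  by (auto simp: FE_space_def PP_def)

lemma open_domain: "open \<Omega>" and domain_ne: "\<Omega> \<noteq> {}" and connected_C: "connected C"
  and compact_C: "compact C"
  and interior_C: "interior C = \<Omega>"
  using domain by (auto simp: polygonal_domain_def intro: connected_imp_connected_closure)

lemma domain_sets: "\<Omega> \<in> sets lebesgue"
  using open_domain by (simp add: borel_open sets_completionI_sets)

lemma measure_domain: "measure lebesgue \<Omega> > 0" "emeasure lebesgue \<Omega> < \<infinity>"
proof -
  have lm: "\<Omega> \<in> lmeasurable" using domain by (auto simp: polygonal_domain_def lmeasurable_open)
  then show "emeasure lebesgue \<Omega> < \<infinity>" unfolding fmeasurable_def by blast
  have "\<not> negligible \<Omega>" using open_domain domain_ne open_not_negligible by blast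
  then show "measure lebesgue \<Omega> > 0"
    using lm by (metis measure_nonneg negligible_iff_measure less_eq_real_def)
qed

lemma finite_mesh: "finite \<T>"
  and mesh_Union: "\<Union>\<T> = C"
  and mesh_simplex: "K \<in> \<T> \<Longrightarrow> 2 simplex K"
  using mesh by (auto simp: triangulates_def triangulation_def)

lemma
  assumes "K \<in> \<T>"
  shows triangle_convex: "convex K" and triangle_compact: "compact K"
    and triangle_interior: "interior K \<noteq> {}" and triangle_sub: "K \<subseteq> C"
    and triangle_interior_sub: "interior K \<subseteq> \<Omega>"
    and triangle_sets: "K \<in> sets lebesgue"
    and triangle_polytope: "polytope K"
proof -
  note s = mesh_simplex[OF assms]
  show p: "polytope K" using s by (rule simplex_imp_polytope)
  show c: "convex K" using p by (rule polytope_imp_convex)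
  show k: "compact K" using p by (rule polytope_imp_compact)
  have "aff_dim K = 2" using s by (rule aff_dim_simplex)
  then have "affine hull K = UNIV" by (simp add: aff_dim_eq_full[symmetric])
  moreover have "K \<noteq> {}" using s by auto
  ultimately show "interior K \<noteq> {}"
    using rel_interior_eq_empty[OF c] rel_interior_interior[of K] by simp
  show sub: "K \<subseteq> C" using mesh_Union assms by blast
  then show "interior K \<subseteq> \<Omega>" using interior_mono[of K C] interior_C by simp
  show "K \<in> sets lebesgue" using k by (simp add: lmeasurable_compact fmeasurableD)
qed

text \<open>The gradient of a piecewise polynomial may jump across edges, and so fail to exist, on this null set.\<close>

definition skeleton :: "(real^2) set" where
  "skeleton = (\<Union>K\<in>\<T>. frontier K)"

lemma negligible_skeleton: "negligible skeleton"
  unfolding skeleton_def using finite_mesh triangle_convex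
  by (intro negligible_Union) (auto intro: negligible_convex_frontier)

lemma off_skeleton:
  assumes "x \<in> C" "x \<notin> skeleton"
  obtains K where "K \<in> \<T>" "x \<in> interior K"
proof -
  obtain K where K: "K \<in> \<T>" "x \<in> K" using assms(1) mesh_Union by blast
  have "x \<in> interior K" using K assms(2) closure_subset[of K] by (auto simp: skeleton_def frontier_def)
  then show ?thesis using K that by blast
qed

lemma grad_domain_interior:
  assumes "K \<in> \<T>" "x \<in> interior K"
  shows "grad \<Omega> v x = grad K v x"
proof -
  have "x \<in> \<Omega>" using assms triangle_interior_sub by blast
  then have "at x within \<Omega> = at x" using open_domain by (rule at_within_open)
  moreover have "at x within K = at x" using assms(2) by (rule at_within_interior)
  ultimately show ?thesis by (simp only: grad_def)
qed

lemma PP_lincomb_closed: "lincomb_closed (PP k)"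
  unfolding lincomb_closed_def
proof (intro conjI ballI allI)
  show "(\<lambda>_. 0) \<in> PP k" using poly_space_const by (force simp: PP_def)
  fix u v and a b :: real assume uv: "u \<in> PP k" "v \<in> PP k"
  show "(\<lambda>x. a * u x + b * v x) \<in> PP k" unfolding PP_def
  proof (intro CollectI conjI ballI)
    show "continuous_on C (\<lambda>x. a * u x + b * v x)"
      using uv by (auto simp: PP_def intro!: continuous_intros)
    fix K assume K: "K \<in> \<T>"
    obtain p where p: "p \<in> poly_space k" "\<forall>x\<in>K. u x = p x" using uv K by (auto simp: PP_def)
    obtain q where q: "q \<in> poly_space k" "\<forall>x\<in>K. v x = q x" using uv K by (auto simp: PP_def)
    show "\<exists>p\<in>poly_space k. \<forall>x\<in>K. a * u x + b * v x = p x"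
      using poly_space_lincomb[OF p(1) q(1), of a b] p(2) q(2) by (intro bexI) auto
  qed
qed

lemma PP_const: "(\<lambda>_. c) \<in> PP k"
  using poly_space_const by (force simp: PP_def)

lemma PP_cong:
  assumes "\<And>x. x \<in> C \<Longrightarrow> u x = v x" "v \<in> PP k"
  shows "u \<in> PP k"
  unfolding PP_def
proof (intro CollectI conjI ballI)
  show "continuous_on C u" using assms by (simp add: PP_def cong: continuous_on_cong)
  fix K assume K: "K \<in> \<T>"
  then obtain p where "p \<in> poly_space k" "\<forall>x\<in>K. v x = p x" using assms by (auto simp: PP_def)
  then show "\<exists>p\<in>poly_space k. \<forall>x\<in>K. u x = p x" using triangle_sub[OF K] assms(1) by (intro bexI) auto
qed

lemma PP_mono: "k \<le> l \<Longrightarrow> PP k \<subseteq> PP l"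
  using poly_space_mono[of k l] by (force simp: PP_def)

lemma PP_cont: "v \<in> PP k \<Longrightarrow> continuous_on C v"
  by (simp add: PP_def)

lemma PP_lincomb: "u \<in> PP k \<Longrightarrow> v \<in> PP k \<Longrightarrow> (\<lambda>x. a * u x + b * v x) \<in> PP k"
  using lincomb_closedD[OF PP_lincomb_closed] .

lemma PP_shift: "u \<in> PP k \<Longrightarrow> (\<lambda>x. u x + c) \<in> PP k"
  using PP_lincomb[OF _ PP_const[of c], of u k 1 1] by simp

lemma PP_quadratic:
  assumes "v \<in> PP 2" "K \<in> \<T>"
  obtains a g H where "transpose H = H" "\<forall>x\<in>K. v x = a + g \<bullet> x + 1/2 * (x \<bullet> (H *v x))"
    "\<forall>x\<in>K. grad K v x = g + H *v x" "\<forall>x\<in>K. hess K v x = H"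
proof -
  obtain p where p: "p \<in> poly_space 2" "\<forall>x\<in>K. v x = p x" using assms by (auto simp: PP_def)
  obtain a g H where H: "transpose H = H" "p = (\<lambda>x. a + g \<bullet> x + 1/2 * (x \<bullet> (H *v x)))"
    using quadratic_form_of_poly_space[OF p(1)] .
  have v: "v x = a + g \<bullet> x + 1/2 * (x \<bullet> (H *v x))" if "x \<in> K" for x using p H that by simp
  note gh = grad_hess_quadratic[OF triangle_convex[OF assms(2)] triangle_interior[OF assms(2)] H(1) v]
  show ?thesis
    by (rule that[OF H(1)]) (use v gh in blast)+
qed

text \<open>Linear combinations are described by their values on the closure of the domain. With coefficients 1
  and 0 the same statement says that the derivatives do not depend on other values; the linearity
  lemmas for the forms below are stated in this way for the same reason.\<close>

lemma grad_hess_lincomb: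
  assumes "u \<in> PP 2" "v \<in> PP 2" "K \<in> \<T>" and f: "\<And>x. x \<in> C \<Longrightarrow> f x = a * u x + b * v x"
    and x: "x \<in> K"
  shows "grad K f x = a *\<^sub>R grad K u x + b *\<^sub>R grad K v x"
    and "hess K f x = a *\<^sub>R hess K u x + b *\<^sub>R hess K v x"
proof -
  obtain a1 g1 H1 where 1: "transpose H1 = H1" "\<forall>x\<in>K. u x = a1 + g1 \<bullet> x + 1/2 * (x \<bullet> (H1 *v x))"
    "\<forall>x\<in>K. grad K u x = g1 + H1 *v x" "\<forall>x\<in>K. hess K u x = H1"
    by (rule PP_quadratic[OF assms(1,3)])
  obtain a2 g2 H2 where 2: "transpose H2 = H2" "\<forall>x\<in>K. v x = a2 + g2 \<bullet> x + 1/2 * (x \<bullet> (H2 *v x))"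
    "\<forall>x\<in>K. grad K v x = g2 + H2 *v x" "\<forall>x\<in>K. hess K v x = H2"
    by (rule PP_quadratic[OF assms(2,3)])
  define H where "H = a *\<^sub>R H1 + b *\<^sub>R H2"
  define g where "g = a *\<^sub>R g1 + b *\<^sub>R g2"
  have H: "transpose H = H" using 1(1) 2(1) by (simp add: H_def transpose_def vec_eq_iff)
  have Hx: "H *v y = a *\<^sub>R (H1 *v y) + b *\<^sub>R (H2 *v y)" for y
    by (simp add: H_def matrix_vector_mult_add_rdistrib scaleR_matrix_vector_assoc)
  have f': "f y = (a * a1 + b * a2) + g \<bullet> y + 1/2 * (y \<bullet> (H *v y))" if "y \<in> K" for y
  proof -
    have "y \<in> C" using that triangle_sub[OF assms(3)] by blast
    then show ?thesis
      unfolding f[OF \<open>y \<in> C\<close>] bspec[OF 1(2) that] bspec[OF 2(2) that] Hx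
      by (simp add: g_def inner_add_left inner_add_right algebra_simps)
  qed
  have gh: "grad K f x = g + H *v x" "hess K f x = H"
    by (rule grad_hess_quadratic[OF triangle_convex[OF assms(3)] triangle_interior[OF assms(3)] H f' x];
        assumption)+
  show "grad K f x = a *\<^sub>R grad K u x + b *\<^sub>R grad K v x"
    unfolding gh(1) bspec[OF 1(3) x] bspec[OF 2(3) x] Hx by (simp add: g_def algebra_simps)
  show "hess K f x = a *\<^sub>R hess K u x + b *\<^sub>R hess K v x"
    unfolding gh(2) bspec[OF 1(4) x] bspec[OF 2(4) x] by (simp add: H_def)
qed

lemma grad_hess_continuous:
  assumes "v \<in> PP 2" "K \<in> \<T>"
  shows "continuous_on K (grad K v)" "continuous_on K (hess K v)"
proof -
  obtain a g H where *: "\<forall>x\<in>K. grad K v x = g + H *v x" "\<forall>x\<in>K. hess K v x = H"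
    by (rule PP_quadratic[OF assms])
  have "continuous_on K (\<lambda>x. g + H *v x)" by (intro continuous_intros linear_continuous_on matrix_vector_mul_bounded_linear)
  then show "continuous_on K (grad K v)" using *(1) by (simp cong: continuous_on_cong)
  show "continuous_on K (hess K v)" using *(2) by (simp cong: continuous_on_cong)
qed

lemma grad_hess_const:
  assumes "K \<in> \<T>" "x \<in> K"
  shows "grad K (\<lambda>_. c) x = 0" "hess K (\<lambda>_. c) x = 0"
proof -
  have "transpose (0 :: real^2^2) = 0" by (simp add: transpose_def vec_eq_iff)
  from grad_hess_quadratic[OF triangle_convex[OF assms(1)] triangle_interior[OF assms(1)] this,
      of "\<lambda>_. c" c 0 x] assms(2)
  show "grad K (\<lambda>_. c) x = 0" "hess K (\<lambda>_. c) x = 0" by simp_all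
qed

section \<open>The mass form\<close>

lemma integrable_C: "continuous_on C f \<Longrightarrow> set_integrable lebesgue \<Omega> (f :: real^2 \<Rightarrow> real)"
  using set_integrable_continuous_on_compact[OF compact_C closure_subset domain_sets] .

lemma mass_lincomb:
  assumes "\<And>x. x \<in> C \<Longrightarrow> f x = a * g x + b * h x"
    and "continuous_on C g" "continuous_on C h" "continuous_on C w"
  shows "L2_ip \<Omega> f w = a * L2_ip \<Omega> g w + b * L2_ip \<Omega> h w"
  using assms closure_subset[of \<Omega>]
  by (intro L2_ip_lincomb integrable_C) (auto intro!: continuous_intros)

lemma mass_lincomb_right:
  assumes "\<And>x. x \<in> C \<Longrightarrow> f x = a * g x + b * h x"
    and "continuous_on C g" "continuous_on C h" "continuous_on C w"
  shows "L2_ip \<Omega> w f = a * L2_ip \<Omega> w g + b * L2_ip \<Omega> w h"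
  using mass_lincomb[OF assms] by (simp add: L2_ip_commute)

lemma mass_one: "L2_ip \<Omega> (\<lambda>_. c) (\<lambda>_. 1) = c * measure lebesgue \<Omega>"
  using measure_domain domain_sets
  by (simp add: L2_ip_def set_lebesgue_integral_def)

lemma mass_nonneg: 
  assumes "\<And>x. x \<in> \<Omega> \<Longrightarrow> u x * v x \<ge> 0"
  shows "L2_ip \<Omega> u (v :: real^2 \<Rightarrow> real) \<ge> 0"
  unfolding L2_ip_def set_lebesgue_integral_def
  using assms by (intro integral_nonneg_AE) (auto split: split_indicator)

text \<open>If the integral of \<open>v\<^sup>2\<close> vanishes, then the set where \<open>v\<close> is nonzero in the domain is both open and
  null, so it is empty, and continuity extends this to the closure.\<close>

lemma mass_definite:
  fixes v :: "real^2 \<Rightarrow> real"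
  assumes v: "continuous_on C v" and x: "x \<in> C" "v x \<noteq> 0"
  shows "L2_ip \<Omega> v v > 0"
proof -
  have ge: "L2_ip \<Omega> v v \<ge> 0" by (rule mass_nonneg) simp
  have "L2_ip \<Omega> v v \<noteq> 0"
  proof
    assume "L2_ip \<Omega> v v = 0"
    moreover have "set_integrable lebesgue \<Omega> (\<lambda>x. v x * v x)" by (intro integrable_C continuous_intros v)
    ultimately have "AE x in lebesgue. indicator \<Omega> x *\<^sub>R (v x * v x) = 0"
      unfolding L2_ip_def set_lebesgue_integral_def set_integrable_def
      by (subst (asm) integral_nonneg_eq_0_iff_AE) (auto split: split_indicator)
    then have "negligible {x \<in> \<Omega>. v x \<noteq> 0}" by (intro negligible_AE) (auto elim!: eventually_mono)
    moreover have "open {x \<in> \<Omega>. v x \<noteq> 0}"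
    proof -
      have "open (\<Omega> \<inter> v -` (- {0}))"
        using continuous_on_subset[OF v closure_subset] open_domain
        by (intro continuous_open_preimage) auto
      moreover have "\<Omega> \<inter> v -` (- {0}) = {x \<in> \<Omega>. v x \<noteq> 0}" by auto
      ultimately show ?thesis by simp
    qed
    ultimately have "{x \<in> \<Omega>. v x \<noteq> 0} = {}" using open_not_negligible by blast
    then have "v x = 0" using continuous_constant_on_closure[OF v _ x(1), of 0] by auto
    with x(2) show False by simp
  qed
  with ge show ?thesis by simp
qed

section \<open>The stiffness form\<close>

text \<open>On the interior of each triangle the integrand is a polynomial; the finitely many interiors cover
  the domain up to a null set.\<close>

lemma stiff_integrable:
  assumes "u \<in> PP 2" "w \<in> PP 2"
  shows "set_integrable lebesgue \<Omega> (\<lambda>x. grad \<Omega> u x \<bullet> grad \<Omega> w x)"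
proof -
  let ?f = "\<lambda>x. grad \<Omega> u x \<bullet> grad \<Omega> w x"
  let ?U = "\<Union>K\<in>\<T>. interior K"
  have sets: "interior K \<in> sets lebesgue" for K :: "(real^2) set"
    by (simp add: borel_open sets_completionI_sets)
  have K: "set_integrable lebesgue (interior K) ?f" if K: "K \<in> \<T>" for K
  proof -
    have "set_integrable lebesgue (interior K) (\<lambda>x. grad K u x \<bullet> grad K w x)"
      by (rule set_integrable_continuous_on_compact[OF triangle_compact[OF K] interior_subset sets])
         (intro continuous_intros grad_hess_continuous assms K)
    moreover have "set_integrable lebesgue (interior K) ?f
        = set_integrable lebesgue (interior K) (\<lambda>x. grad K u x \<bullet> grad K w x)"
      by (intro set_integrable_cong refl) (simp add: grad_domain_interior[OF K])
    ultimately show ?thesis by blast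
  qed
  have U: "set_integrable lebesgue ?U ?f"
    by (intro set_integrable_UN finite_mesh K sets)
  have "?U - \<Omega> = {}" using triangle_interior_sub by blast
  then have "{x \<in> ?U - \<Omega>. ?f x \<noteq> 0} = {}" by blast
  then have 1: "negligible {x \<in> ?U - \<Omega>. ?f x \<noteq> 0}" by (simp only: negligible_empty)
  have "{x \<in> \<Omega> - ?U. ?f x \<noteq> 0} \<subseteq> skeleton"
    using off_skeleton closure_subset by blast
  then have 2: "negligible {x \<in> \<Omega> - ?U. ?f x \<noteq> 0}"
    using negligible_skeleton negligible_subset by blast
  show ?thesis using U absolutely_integrable_spike_set_eq[OF 1 2] by blast
qed

lemma stiff_lincomb:
  assumes u: "u \<in> PP 2" and v: "v \<in> PP 2" and w: "w \<in> PP 2"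
    and f: "\<And>x. x \<in> C \<Longrightarrow> f x = a * u x + b * v x"
  shows "L2_ip \<Omega> (grad \<Omega> f) (grad \<Omega> w)
       = a * L2_ip \<Omega> (grad \<Omega> u) (grad \<Omega> w) + b * L2_ip \<Omega> (grad \<Omega> v) (grad \<Omega> w)"
proof -
  have fP: "f \<in> PP 2" using PP_cong[OF f PP_lincomb[OF u v]] .
  note iu = set_lebesgue_integral_eq_integral[OF stiff_integrable[OF u w]]
    and iv = set_lebesgue_integral_eq_integral[OF stiff_integrable[OF v w]]
    and jf = set_lebesgue_integral_eq_integral[OF stiff_integrable[OF fP w]]
  have "integral \<Omega> (\<lambda>x. grad \<Omega> f x \<bullet> grad \<Omega> w x)
      = integral \<Omega> (\<lambda>x. a * (grad \<Omega> u x \<bullet> grad \<Omega> w x) + b * (grad \<Omega> v x \<bullet> grad \<Omega> w x))"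
  proof (rule integral_spike[OF negligible_skeleton])
    fix x assume "x \<in> \<Omega> - skeleton"
    then obtain K where K: "K \<in> \<T>" "x \<in> interior K"
      using off_skeleton[of x] closure_subset by blast
    then have x: "x \<in> K" using interior_subset by blast
    have l: "grad K f x = a *\<^sub>R grad K u x + b *\<^sub>R grad K v x"
      by (intro grad_hess_lincomb u v K x f; assumption)
    show "a * (grad \<Omega> u x \<bullet> grad \<Omega> w x) + b * (grad \<Omega> v x \<bullet> grad \<Omega> w x)
        = grad \<Omega> f x \<bullet> grad \<Omega> w x"
      unfolding grad_domain_interior[OF K] l
      by (simp add: inner_add_left)
  qed
  also have "\<dots> = a * integral \<Omega> (\<lambda>x. grad \<Omega> u x \<bullet> grad \<Omega> w x) + b * integral \<Omega> (\<lambda>x. grad \<Omega> v x \<bullet> grad \<Omega> w x)"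
    using iu(1) iv(1) by (subst integral_add) (auto intro: integrable_on_mult_right)
  finally show ?thesis unfolding L2_ip_def iu(2) iv(2) jf(2) .
qed

lemma stiff_const:
  assumes w: "w \<in> PP 2"
  shows "L2_ip \<Omega> (grad \<Omega> (\<lambda>_. c)) (grad \<Omega> w) = 0"
proof -
  have "integral \<Omega> (\<lambda>x. grad \<Omega> (\<lambda>_. c) x \<bullet> grad \<Omega> w x) = integral \<Omega> (\<lambda>x. 0)"
  proof (rule integral_spike[OF negligible_skeleton])
    fix x assume "x \<in> \<Omega> - skeleton"
    then obtain K where K: "K \<in> \<T>" "x \<in> interior K"
      using off_skeleton[of x] closure_subset by blast
    then have x: "x \<in> K" using interior_subset by blast
    show "0 = grad \<Omega> (\<lambda>_. c) x \<bullet> grad \<Omega> w x"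
      unfolding grad_domain_interior[OF K] grad_hess_const(1)[OF K(1) x] by simp
  qed
  then show ?thesis
    unfolding L2_ip_def set_lebesgue_integral_eq_integral(2)[OF stiff_integrable[OF PP_const w]]
    by simp
qed

lemma stiff_nonneg: "L2_ip \<Omega> (grad \<Omega> u) (grad \<Omega> u) \<ge> 0"
  unfolding L2_ip_def set_lebesgue_integral_def
  by (intro integral_nonneg_AE) (auto split: split_indicator)

text \<open>A continuous piecewise affine function whose gradient vanishes almost everywhere is constant on
  each triangle. It takes finitely many values on a connected set and is therefore constant.\<close>

lemma stiff_definite:
  assumes v: "v \<in> PP 1" and z: "L2_ip \<Omega> (grad \<Omega> v) (grad \<Omega> v) = 0"
  obtains c where "\<And>x. x \<in> C \<Longrightarrow> v x = c"
proof -
  have v2: "v \<in> PP 2" using v PP_mono[of 1 2] by auto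
  have "AE x in lebesgue. indicator \<Omega> x *\<^sub>R (grad \<Omega> v x \<bullet> grad \<Omega> v x) = 0"
    using z stiff_integrable[OF v2 v2]
    unfolding L2_ip_def set_lebesgue_integral_def set_integrable_def
    by (subst (asm) integral_nonneg_eq_0_iff_AE) (auto split: split_indicator)
  then have N: "negligible {x \<in> \<Omega>. grad \<Omega> v x \<noteq> 0}"
    by (intro negligible_AE) (auto elim!: eventually_mono)
  have "\<exists>a. \<forall>x\<in>K. v x = a" if K: "K \<in> \<T>" for K
  proof -
    obtain p where p: "p \<in> poly_space 1" "\<forall>x\<in>K. v x = p x" using v K by (auto simp: PP_def)
    obtain a g where ag: "p = (\<lambda>x. a + g \<bullet> x)" using poly_space_affine[OF p(1)] by blast
    have tr: "transpose (0 :: real^2^2) = 0" by (simp add: transpose_def vec_eq_iff)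
    have gr: "grad K v x = g" if x: "x \<in> K" for x
      using grad_hess_quadratic(1)[OF triangle_convex[OF K] triangle_interior[OF K] tr _ x, of v a g]
        p(2) ag by simp
    have "g = 0"
    proof (rule ccontr)
      assume "g \<noteq> 0"
      then have "interior K \<subseteq> {x \<in> \<Omega>. grad \<Omega> v x \<noteq> 0}"
        using gr grad_domain_interior[OF K] triangle_interior_sub[OF K] interior_subset[of K] by auto
      then have "negligible (interior K)" using N negligible_subset by blast
      then show False using open_not_negligible[of "interior K"] triangle_interior[OF K] by simp
    qed
    then show ?thesis using p(2) ag by auto
  qed
  then obtain a where a: "\<And>K x. K \<in> \<T> \<Longrightarrow> x \<in> K \<Longrightarrow> v x = a K" by metis
  have "v ` C \<subseteq> a ` \<T>" using a mesh_Union by (auto simp flip: mesh_Union)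
  then have "finite (v ` C)" using finite_mesh finite_surj by blast
  then have "v constant_on C" using continuous_finite_range_constant[OF connected_C PP_cont[OF v]] by blast
  then show ?thesis using that by (auto simp: constant_on_def)
qed

section \<open>The interior penalty form\<close>

lemma edge_segment:
  assumes "e \<in> edges \<T>"
  shows "\<exists>a b. e = closed_segment a b"
proof -
  obtain K where K: "K \<in> \<T>" "e face_of K" "aff_dim e = 1" using assms by (auto simp: edges_def edge_of_def)
  have "compact e" "convex e"
    using face_of_imp_compact[OF triangle_convex[OF K(1)] triangle_compact[OF K(1)] K(2)]
      face_of_imp_convex[OF K(2)] by auto
  moreover have "e \<noteq> {}" "collinear e" using K(3) by (auto simp: collinear_aff_dim)
  ultimately show ?thesis by (metis compact_convex_collinear_segment)
qed

text \<open>Interior and boundary edges are treated alike: the jump is a fixed linear expression in the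
  one-sided gradients, and the average one in the one-sided Hessians, of at most two triangles that
  contain the edge. For a boundary edge both triangles are the same and the second term is zero.\<close>

lemma edge_traces:
  assumes e: "e \<in> edges \<T>"
  obtains K1 K2 m1 m2 n and r1 r2 :: real where "K1 \<in> \<T>" "K2 \<in> \<T>" "e \<subseteq> K1" "e \<subseteq> K2"
    and "\<forall>v x. jump_dn \<T> e v x = m1 \<bullet> grad K1 v x + m2 \<bullet> grad K2 v x"
    and "\<forall>v x. avg_dnn \<T> e v x = r1 * (n \<bullet> (hess K1 v x *v n)) + r2 * (n \<bullet> (hess K2 v x *v n))"
proof (cases "interior_edge \<T> e")
  case True
  let ?P = "\<lambda>(Km, Kp). Km \<in> \<T> \<and> Kp \<in> \<T> \<and> Km \<noteq> Kp \<and> e edge_of Km \<and> e edge_of Kp"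
  have "\<exists>p. ?P p" using True by (auto simp: interior_edge_def)
  then have P: "?P (edge_pair \<T> e)" unfolding edge_pair_def by (rule someI_ex)
  obtain Km Kp where p: "edge_pair \<T> e = (Km, Kp)" by fastforce
  define n where "n = outer_normal Km e"
  show ?thesis
    by (rule that[of Km Kp "- n" n "1/2" n "1/2"])
       (use P True in \<open>auto simp: p jump_dn_def avg_dnn_def Let_def n_def inner_diff_right
          distrib_left dest: edge_of_imp_subset\<close>)
next
  case False
  obtain K where K: "K \<in> \<T>" "e edge_of K" using e by (auto simp: edges_def)
  have "boundary_triangle \<T> e = K" unfolding boundary_triangle_def
    using K False by (intro the_equality) (auto simp: interior_edge_def)
  then show ?thesis
    by (intro that[of K K "- outer_normal K e" 0 1 "outer_normal K e" 0])
       (use K False in \<open>auto simp: jump_dn_def avg_dnn_def Let_def dest: edge_of_imp_subset\<close>)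
qed

lemma trace_lincomb:
  assumes e: "e \<in> edges \<T>" and u: "u \<in> PP 2" and v: "v \<in> PP 2"
    and f: "\<And>x. x \<in> C \<Longrightarrow> f x = a * u x + b * v x" and x: "x \<in> e"
  shows "jump_dn \<T> e f x = a * jump_dn \<T> e u x + b * jump_dn \<T> e v x"
    and "avg_dnn \<T> e f x = a * avg_dnn \<T> e u x + b * avg_dnn \<T> e v x"
proof -
  obtain K1 K2 m1 m2 n r1 r2 where K: "K1 \<in> \<T>" "K2 \<in> \<T>" "e \<subseteq> K1" "e \<subseteq> K2"
    and J: "\<forall>v x. jump_dn \<T> e v x = m1 \<bullet> grad K1 v x + m2 \<bullet> grad K2 v x"
    and A: "\<forall>v x. avg_dnn \<T> e v x = r1 * (n \<bullet> (hess K1 v x *v n)) + r2 * (n \<bullet> (hess K2 v x *v n))"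
    by (rule edge_traces[OF e])
  have x: "x \<in> K1" "x \<in> K2" using K x by auto
  have l: "grad K f x = a *\<^sub>R grad K u x + b *\<^sub>R grad K v x"
    "hess K f x = a *\<^sub>R hess K u x + b *\<^sub>R hess K v x" if "K \<in> \<T>" "x \<in> K" for K
    by (intro grad_hess_lincomb u v that f; assumption)+
  note l1 = l[OF K(1) x(1)] and l2 = l[OF K(2) x(2)]
  show "jump_dn \<T> e f x = a * jump_dn \<T> e u x + b * jump_dn \<T> e v x"
    unfolding J[rule_format] l1 l2 by (simp add: inner_add_right algebra_simps)
  show "avg_dnn \<T> e f x = a * avg_dnn \<T> e u x + b * avg_dnn \<T> e v x"
    unfolding A[rule_format] l1 l2
    by (simp add: inner_add_right matrix_vector_mult_add_rdistrib scaleR_matrix_vector_assoc[symmetric] algebra_simps)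
qed

lemma trace_const:
  assumes e: "e \<in> edges \<T>" and x: "x \<in> e"
  shows "jump_dn \<T> e (\<lambda>_. c) x = 0" and "avg_dnn \<T> e (\<lambda>_. c) x = 0"
proof -
  obtain K1 K2 m1 m2 n r1 r2 where K: "K1 \<in> \<T>" "K2 \<in> \<T>" "e \<subseteq> K1" "e \<subseteq> K2"
    and J: "\<forall>v x. jump_dn \<T> e v x = m1 \<bullet> grad K1 v x + m2 \<bullet> grad K2 v x"
    and A: "\<forall>v x. avg_dnn \<T> e v x = r1 * (n \<bullet> (hess K1 v x *v n)) + r2 * (n \<bullet> (hess K2 v x *v n))"
    by (rule edge_traces[OF e])
  have x: "x \<in> K1" "x \<in> K2" using K x by auto
  show "jump_dn \<T> e (\<lambda>_. c) x = 0" "avg_dnn \<T> e (\<lambda>_. c) x = 0"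
    unfolding J[rule_format] A[rule_format] grad_hess_const[OF K(1) x(1)] grad_hess_const[OF K(2) x(2)]
    by simp_all
qed

lemma trace_continuous:
  assumes e: "e \<in> edges \<T>" and v: "v \<in> PP 2"
  shows "continuous_on e (jump_dn \<T> e v)" and "continuous_on e (avg_dnn \<T> e v)"
proof -
  obtain K1 K2 m1 m2 n r1 r2 where K: "K1 \<in> \<T>" "K2 \<in> \<T>" "e \<subseteq> K1" "e \<subseteq> K2"
    and J: "\<forall>v x. jump_dn \<T> e v x = m1 \<bullet> grad K1 v x + m2 \<bullet> grad K2 v x"
    and A: "\<forall>v x. avg_dnn \<T> e v x = r1 * (n \<bullet> (hess K1 v x *v n)) + r2 * (n \<bullet> (hess K2 v x *v n))"
    by (rule edge_traces[OF e])
  have "continuous_on e (\<lambda>x. m1 \<bullet> grad K1 v x + m2 \<bullet> grad K2 v x)"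
    by (intro continuous_intros continuous_on_subset[OF grad_hess_continuous(1)] v K)
  then show "continuous_on e (jump_dn \<T> e v)" using J by (simp cong: continuous_on_cong)
  obtain H1 where H1: "\<forall>x\<in>K1. hess K1 v x = H1" by (rule PP_quadratic[OF v K(1)])
  obtain H2 where H2: "\<forall>x\<in>K2. hess K2 v x = H2" by (rule PP_quadratic[OF v K(2)])
  have "continuous_on e (avg_dnn \<T> e v) \<longleftrightarrow>
      continuous_on e (\<lambda>x. r1 * (n \<bullet> (H1 *v n)) + r2 * (n \<bullet> (H2 *v n)))"
    using A H1 H2 K(3,4) by (intro continuous_on_cong refl) (simp add: subset_iff)
  then show "continuous_on e (avg_dnn \<T> e v)" by simp
qed

lemma a_IP_commute: "a_IP \<T> \<alpha> w v = a_IP \<T> \<alpha> v w"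
  unfolding a_IP_def
  by (simp add: L2_ip_commute[of _ "hess _ w"] mult.commute[of "jump_dn \<T> _ w _"])

lemma a_IP_lincomb:
  assumes u: "u \<in> PP 2" and v: "v \<in> PP 2" and w: "w \<in> PP 2"
    and f: "\<And>x. x \<in> C \<Longrightarrow> f x = a * u x + b * v x"
  shows "a_IP \<T> \<alpha> f w = a * a_IP \<T> \<alpha> u w + b * a_IP \<T> \<alpha> v w"
proof -
  have 1: "(\<Sum>K\<in>\<T>. L2_ip K (hess K f) (hess K w))
    = a * (\<Sum>K\<in>\<T>. L2_ip K (hess K u) (hess K w)) + b * (\<Sum>K\<in>\<T>. L2_ip K (hess K v) (hess K w))"
  proof (rule sum_lincomb)
    fix K assume K: "K \<in> \<T>"
    have int: "set_integrable lebesgue K (\<lambda>x. hess K z x \<bullet> hess K w x)" if "z \<in> PP 2" for z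
      by (rule set_integrable_continuous_on_compact[OF triangle_compact[OF K] order_refl triangle_sets[OF K]])
         (intro continuous_intros grad_hess_continuous that w K)
    show "L2_ip K (hess K f) (hess K w) = a * L2_ip K (hess K u) (hess K w) + b * L2_ip K (hess K v) (hess K w)"
      by (intro L2_ip_lincomb grad_hess_lincomb(2) u v K f int)
  qed
  note cont = continuous_on_mult trace_continuous u v w
  have 2: "(\<Sum>e\<in>edges \<T>. edge_integral e (\<lambda>x. avg_dnn \<T> e f x * jump_dn \<T> e w x))
    = a * (\<Sum>e\<in>edges \<T>. edge_integral e (\<lambda>x. avg_dnn \<T> e u x * jump_dn \<T> e w x))
    + b * (\<Sum>e\<in>edges \<T>. edge_integral e (\<lambda>x. avg_dnn \<T> e v x * jump_dn \<T> e w x))"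
    by (intro sum_lincomb edge_integral_lincomb edge_segment cont)
       (simp_all add: trace_lincomb(2)[OF _ u v f] algebra_simps)
  have 3: "(\<Sum>e\<in>edges \<T>. edge_integral e (\<lambda>x. avg_dnn \<T> e w x * jump_dn \<T> e f x))
    = a * (\<Sum>e\<in>edges \<T>. edge_integral e (\<lambda>x. avg_dnn \<T> e w x * jump_dn \<T> e u x))
    + b * (\<Sum>e\<in>edges \<T>. edge_integral e (\<lambda>x. avg_dnn \<T> e w x * jump_dn \<T> e v x))"
    by (intro sum_lincomb edge_integral_lincomb edge_segment cont)
       (simp_all add: trace_lincomb(1)[OF _ u v f] algebra_simps)
  have 4: "(\<Sum>e\<in>edges \<T>. 1 / diameter e * edge_integral e (\<lambda>x. jump_dn \<T> e f x * jump_dn \<T> e w x))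
    = a * (\<Sum>e\<in>edges \<T>. 1 / diameter e * edge_integral e (\<lambda>x. jump_dn \<T> e u x * jump_dn \<T> e w x))
    + b * (\<Sum>e\<in>edges \<T>. 1 / diameter e * edge_integral e (\<lambda>x. jump_dn \<T> e v x * jump_dn \<T> e w x))"
  proof (rule sum_lincomb)
    fix e assume e: "e \<in> edges \<T>"
    have "edge_integral e (\<lambda>x. jump_dn \<T> e f x * jump_dn \<T> e w x)
      = a * edge_integral e (\<lambda>x. jump_dn \<T> e u x * jump_dn \<T> e w x)
      + b * edge_integral e (\<lambda>x. jump_dn \<T> e v x * jump_dn \<T> e w x)"
      by (intro edge_integral_lincomb edge_segment cont e)
         (simp_all add: trace_lincomb(1)[OF e u v f] algebra_simps)
    then show "1 / diameter e * edge_integral e (\<lambda>x. jump_dn \<T> e f x * jump_dn \<T> e w x)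
      = a * (1 / diameter e * edge_integral e (\<lambda>x. jump_dn \<T> e u x * jump_dn \<T> e w x))
      + b * (1 / diameter e * edge_integral e (\<lambda>x. jump_dn \<T> e v x * jump_dn \<T> e w x))"
      by (simp only: distrib_left mult.left_commute)
  qed
  show ?thesis unfolding a_IP_def 1 2 3 4 by (simp add: algebra_simps)
qed

lemma a_IP_const:
  assumes w: "w \<in> PP 2"
  shows "a_IP \<T> \<alpha> (\<lambda>_. c) w = 0"
proof -
  have 1: "L2_ip K (hess K (\<lambda>_. c)) (hess K w) = 0" if "K \<in> \<T>" for K
    unfolding L2_ip_def set_lebesgue_integral_def
    by (intro integral_eq_zero_AE AE_I2) (auto simp: grad_hess_const[OF that] split: split_indicator)
  have 2: "edge_integral e f = 0" if "e \<in> edges \<T>" "\<And>x. x \<in> e \<Longrightarrow> f x = 0" for e f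
    using edge_integral_lincomb[OF edge_segment[OF that(1)], of f 0 "\<lambda>_. 0" 0 "\<lambda>_. 0"] that(2) by simp
  show ?thesis unfolding a_IP_def by (simp add: 1 2 trace_const)
qed

lemma stiff_lincomb_right:
  assumes "u \<in> PP 2" "v \<in> PP 2" "w \<in> PP 2" "\<And>x. x \<in> C \<Longrightarrow> f x = a * u x + b * v x"
  shows "L2_ip \<Omega> (grad \<Omega> w) (grad \<Omega> f)
       = a * L2_ip \<Omega> (grad \<Omega> w) (grad \<Omega> u) + b * L2_ip \<Omega> (grad \<Omega> w) (grad \<Omega> v)"
  using stiff_lincomb[OF assms] by (simp add: L2_ip_commute[of _ "grad _ w"])

lemma stiff_const_right: "w \<in> PP 2 \<Longrightarrow> L2_ip \<Omega> (grad \<Omega> w) (grad \<Omega> (\<lambda>_. c)) = 0"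
  using stiff_const[of w c] by (simp add: L2_ip_commute[of _ "grad _ w"])

lemma a_IP_lincomb_right:
  assumes "u \<in> PP 2" "v \<in> PP 2" "w \<in> PP 2" "\<And>x. x \<in> C \<Longrightarrow> f x = a * u x + b * v x"
  shows "a_IP \<T> \<alpha> w f = a * a_IP \<T> \<alpha> w u + b * a_IP \<T> \<alpha> w v"
  using a_IP_lincomb[OF assms, of \<alpha>] by (simp add: a_IP_commute[of _ w])

lemma a_IP_const_right: "w \<in> PP 2 \<Longrightarrow> a_IP \<T> \<alpha> w (\<lambda>_. c) = 0"
  using a_IP_const[of w \<alpha> c] by (simp add: a_IP_commute[of _ w])

lemma mass_cong:
  fixes u v :: "real^2 \<Rightarrow> real"
  assumes "\<And>x. x \<in> C \<Longrightarrow> u x = u' x" "\<And>x. x \<in> C \<Longrightarrow> v x = v' x"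
  shows "L2_ip \<Omega> u v = L2_ip \<Omega> u' v'"
  unfolding L2_ip_def
  by (rule set_lebesgue_integral_cong[OF domain_sets]) (use assms closure_subset[of \<Omega>] in auto)

section \<open>Functions of mean zero\<close>

text \<open>Collecting the six points of each triangle shows that the finite element space has finite
  dimension, in the form in which the Gram--Schmidt lemma uses it.\<close>

lemma determining_points:
  obtains P where "finite P" "P \<subseteq> C" "\<And>v. v \<in> PP 2 \<Longrightarrow> \<forall>p\<in>P. v p = 0 \<Longrightarrow> \<forall>x\<in>C. v x = 0"
proof -
  have "\<exists>P. finite P \<and> P \<subseteq> K \<and> (\<forall>p. p \<in> poly_space 2 \<longrightarrow> (\<forall>x\<in>P. p x = 0) \<longrightarrow> p = (\<lambda>_. 0))"
    if K: "K \<in> \<T>" for K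
    by (rule quadratic_determining_points[OF triangle_interior[OF K]]) blast
  then have "\<forall>K\<in>\<T>. \<exists>P. finite P \<and> P \<subseteq> K \<and>
      (\<forall>p. p \<in> poly_space 2 \<longrightarrow> (\<forall>x\<in>P. p x = 0) \<longrightarrow> p = (\<lambda>_. 0))" by (rule ballI)
  from bchoice[OF this] obtain P where all: "\<forall>K\<in>\<T>. finite (P K) \<and> P K \<subseteq> K \<and>
      (\<forall>p. p \<in> poly_space 2 \<longrightarrow> (\<forall>x\<in>P K. p x = 0) \<longrightarrow> p = (\<lambda>_. 0))" ..
  then have P: "finite (P K)" "P K \<subseteq> K" if "K \<in> \<T>" for K using that by auto
  show ?thesis
  proof (rule that[of "\<Union>K\<in>\<T>. P K"])
    show "finite (\<Union>K\<in>\<T>. P K)" using finite_mesh P(1) by blast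
    show "(\<Union>K\<in>\<T>. P K) \<subseteq> C" using P(2) triangle_sub by blast
    fix v assume v: "v \<in> PP 2" "\<forall>p\<in>\<Union>K\<in>\<T>. P K. v p = 0"
    show "\<forall>x\<in>C. v x = 0"
    proof
      fix x assume "x \<in> C"
      then obtain K where K: "K \<in> \<T>" "x \<in> K" using mesh_Union by blast
      obtain p where p: "p \<in> poly_space 2" "\<forall>x\<in>K. v x = p x" using v(1) K(1) by (auto simp: PP_def)
      have "\<forall>x\<in>P K. p x = 0" using v(2) p(2) P(2)[OF K(1)] K(1) by fastforce
      then have "p = (\<lambda>_. 0)" using bspec[OF all K(1)] p(1) by (elim conjE allE[of _ p]) (rule mp, rule mp)
      then show "v x = 0" using p(2) K(2) by simp
    qed
  qed
qed

definition PP0 :: "nat \<Rightarrow> (real^2 \<Rightarrow> real) set" where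
  "PP0 k = {v \<in> PP k. L2_ip \<Omega> v (\<lambda>_. 1) = 0}"

lemma PP0_PP: "v \<in> PP0 k \<Longrightarrow> v \<in> PP k"
  by (simp add: PP0_def)

lemma PP0_mean: "v \<in> PP0 k \<Longrightarrow> L2_ip \<Omega> v (\<lambda>_. 1) = 0"
  by (simp add: PP0_def)

lemma PP1_PP2: "v \<in> PP 1 \<Longrightarrow> v \<in> PP 2"
  using PP_mono[of 1 2] by auto

lemma PP0_lincomb:
  assumes "u \<in> PP0 k" "v \<in> PP0 k" "\<And>x. x \<in> C \<Longrightarrow> f x = a * u x + b * v x"
  shows "f \<in> PP0 k"
proof -
  have "f \<in> PP k" using PP_cong[OF assms(3) PP_lincomb[OF PP0_PP[OF assms(1)] PP0_PP[OF assms(2)]]] .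
  moreover have "L2_ip \<Omega> f (\<lambda>_. 1) = a * L2_ip \<Omega> u (\<lambda>_. 1) + b * L2_ip \<Omega> v (\<lambda>_. 1)"
    using assms by (intro mass_lincomb PP_cont[OF PP0_PP] continuous_intros)
  ultimately show ?thesis using assms by (simp add: PP0_def)
qed

lemma PP0_lincomb_closed: "lincomb_closed (PP0 k)"
proof -
  have "(\<lambda>_. 0) \<in> PP0 k" using PP_const mass_one[of 0] by (simp add: PP0_def)
  then show ?thesis unfolding lincomb_closed_def by (auto intro: PP0_lincomb)
qed

lemma FE_space_zero_mean: "FE_space k \<Omega> \<T> \<inter> L20 \<Omega> = PP0 k \<inter> extensional C"
proof -
  have "v \<in> L20 \<Omega> \<longleftrightarrow> L2_ip \<Omega> v (\<lambda>_. 1) = 0" if "v \<in> PP k" for v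
  proof -
    have "set_integrable lebesgue \<Omega> v" "set_integrable lebesgue \<Omega> (\<lambda>x. (v x)\<^sup>2)"
      using PP_cont[OF that] by (intro integrable_C continuous_intros; assumption)+
    then show ?thesis
      unfolding L20_def set_borel_measurable_def by (auto simp: set_integrable_def)
  qed
  then show ?thesis by (auto simp: FE_space_eq PP0_def)
qed

lemma PP_restrict: "v \<in> PP k \<Longrightarrow> restrict v C \<in> PP k"
  by (rule PP_cong[of _ v]) auto

lemma PP0_restrict: "v \<in> PP0 k \<Longrightarrow> restrict v C \<in> PP0 k"
  by (rule PP0_lincomb[of v _ v _ 1 0]) auto

lemma zero_mean_decomposition:
  assumes \<psi>: "\<psi> \<in> PP k"
  obtains c \<psi>0 where "\<psi>0 \<in> PP0 k" "\<And>x. x \<in> C \<Longrightarrow> \<psi> x = \<psi>0 x + c"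
proof -
  define c where "c = L2_ip \<Omega> \<psi> (\<lambda>_. 1) / measure lebesgue \<Omega>"
  define \<psi>0 where "\<psi>0 = (\<lambda>x. \<psi> x - c)"
  have "\<psi>0 \<in> PP k" using PP_shift[OF \<psi>, of "- c"] by (simp add: \<psi>0_def)
  moreover have "L2_ip \<Omega> \<psi>0 (\<lambda>_. 1) = 1 * L2_ip \<Omega> \<psi> (\<lambda>_. 1) + (- c) * L2_ip \<Omega> (\<lambda>_. 1 :: real) (\<lambda>_. 1)"
    by (intro mass_lincomb PP_cont[OF \<psi>] continuous_intros) (simp add: \<psi>0_def)
  ultimately have "\<psi>0 \<in> PP0 k" using mass_one[of 1] measure_domain(1) by (simp add: PP0_def c_def)
  then show ?thesis by (rule that[of _ c]) (simp add: \<psi>0_def)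
qed

lemma constant_zero_mean:
  assumes "v \<in> PP0 k" "\<And>x. x \<in> C \<Longrightarrow> v x = c"
  shows "c = 0"
proof -
  have "L2_ip \<Omega> v (\<lambda>_. 1) = L2_ip \<Omega> (\<lambda>_. c) (\<lambda>_. 1)" by (rule mass_cong) (use assms in auto)
  then show ?thesis using PP0_mean[OF assms(1)] mass_one[of c] measure_domain(1) by simp
qed

lemma stiff_positive:
  assumes v: "v \<in> PP0 1" and x: "x \<in> C" "v x \<noteq> 0"
  shows "L2_ip \<Omega> (grad \<Omega> v) (grad \<Omega> v) > 0"
proof (rule ccontr)
  assume "\<not> ?thesis"
  then have "L2_ip \<Omega> (grad \<Omega> v) (grad \<Omega> v) = 0" using stiff_nonneg[of v] by linarith
  then obtain c where c: "\<And>x. x \<in> C \<Longrightarrow> v x = c"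
    using stiff_definite[OF PP0_PP[OF v]] by blast
  then show False using constant_zero_mean[OF v c] x by simp
qed

end

lemma functional_zero_on_span:
  fixes n :: nat
  assumes V: "lincomb_closed V"
    and L: "\<And>u v f a b. u \<in> V \<Longrightarrow> v \<in> V \<Longrightarrow> (\<And>x. x \<in> C \<Longrightarrow> f x = a * u x + b * v x)
          \<Longrightarrow> L f = a * L u + b * L v"
    and e: "\<And>i. i < n \<Longrightarrow> e i \<in> V" "\<And>i. i < n \<Longrightarrow> L (e i) = (0::real)"
    and w: "\<forall>x\<in>C. w x = (\<Sum>i<n. c i * e i x)"
  shows "L w = 0"
proof -
  let ?s = "\<lambda>x. \<Sum>i<n. c i * e i x"
  have s: "?s \<in> V" using lincomb_closed_sum[OF V] e(1) by blast
  have "functional_on V L" unfolding functional_on_def by (intro ballI allI L) auto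
  from functional_on_sum[OF V this, of n e c] e have "L ?s = 0" by simp
  moreover have "L w = 1 * L ?s + 0 * L ?s" by (rule L[OF s s]) (use w in simp)
  ultimately show ?thesis by simp
qed

section \<open>Existence and uniqueness for the problem with mean zero\<close>

text \<open>The parameter \<open>\<phi>p\<close> is the previous solution minus its mean. Coercivity enters as nonnegativity of the
  interior penalty form; definiteness comes from the term with \<open>1 - \<epsilon> > 0\<close>.\<close>

locale time_step = fe_mesh +
  fixes \<alpha> \<epsilon> \<tau> \<phi>bar :: real and \<phi>p :: "real^2 \<Rightarrow> real"
  assumes \<tau>: "\<tau> > 0" and \<epsilon>: "\<epsilon> < 1"
    and a_nonneg: "\<And>w. w \<in> PP 2 \<Longrightarrow> a_IP \<T> \<alpha> w w \<ge> 0"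
    and \<phi>p: "\<phi>p \<in> PP0 2"
begin

abbreviation "mass u v \<equiv> L2_ip \<Omega> u v"
abbreviation "stiff u v \<equiv> L2_ip \<Omega> (grad \<Omega> u) (grad \<Omega> v)"

definition residual :: "(real^2 \<Rightarrow> real) \<Rightarrow> (real^2 \<Rightarrow> real) \<Rightarrow> (real^2 \<Rightarrow> real) \<Rightarrow> real" where
  "residual \<phi> \<mu> \<psi> = a_IP \<T> \<alpha> \<phi> \<psi> + mass (\<lambda>x. (\<phi> x + \<phi>bar) ^ 3) \<psi>
     + (1 - \<epsilon>) * mass (\<lambda>x. \<phi> x + \<phi>bar) \<psi> - mass \<mu> \<psi> - 2 * stiff \<phi>p \<psi>"

definition mass_residual :: "(real^2 \<Rightarrow> real) \<Rightarrow> (real^2 \<Rightarrow> real) \<Rightarrow> (real^2 \<Rightarrow> real) \<Rightarrow> real" where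
  "mass_residual \<phi> \<mu> \<nu> = mass (\<lambda>x. (\<phi> x - \<phi>p x) / \<tau>) \<nu> + stiff \<mu> \<nu>"

definition weak_solution :: "(real^2 \<Rightarrow> real) \<Rightarrow> (real^2 \<Rightarrow> real) \<Rightarrow> bool" where
  "weak_solution \<phi> \<mu> \<longleftrightarrow> \<phi> \<in> PP0 2 \<and> \<mu> \<in> PP0 1 \<and>
     (\<forall>\<psi>\<in>PP0 2. residual \<phi> \<mu> \<psi> = 0) \<and> (\<forall>\<nu>\<in>PP0 1. mass_residual \<phi> \<mu> \<nu> = 0)"

lemma residual_lincomb:
  assumes \<phi>: "\<phi> \<in> PP 2" and \<mu>: "\<mu> \<in> PP 1" and u: "u \<in> PP 2" and v: "v \<in> PP 2"
    and f: "\<And>x. x \<in> C \<Longrightarrow> f x = a * u x + b * v x"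
  shows "residual \<phi> \<mu> f = a * residual \<phi> \<mu> u + b * residual \<phi> \<mu> v"
proof -
  have 1: "mass (\<lambda>x. (\<phi> x + \<phi>bar) ^ 3) f
      = a * mass (\<lambda>x. (\<phi> x + \<phi>bar) ^ 3) u + b * mass (\<lambda>x. (\<phi> x + \<phi>bar) ^ 3) v"
    by (intro mass_lincomb_right f PP_cont[OF u] PP_cont[OF v] continuous_intros PP_cont[OF \<phi>]; assumption)
  have 2: "mass (\<lambda>x. \<phi> x + \<phi>bar) f = a * mass (\<lambda>x. \<phi> x + \<phi>bar) u + b * mass (\<lambda>x. \<phi> x + \<phi>bar) v"
    by (intro mass_lincomb_right f PP_cont[OF u] PP_cont[OF v] continuous_intros PP_cont[OF \<phi>]; assumption)
  have 3: "mass \<mu> f = a * mass \<mu> u + b * mass \<mu> v"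
    by (intro mass_lincomb_right f PP_cont[OF u] PP_cont[OF v] PP_cont[OF \<mu>]; assumption)
  have 4: "a_IP \<T> \<alpha> \<phi> f = a * a_IP \<T> \<alpha> \<phi> u + b * a_IP \<T> \<alpha> \<phi> v"
    by (intro a_IP_lincomb_right u v \<phi> f; assumption)
  have 5: "stiff \<phi>p f = a * stiff \<phi>p u + b * stiff \<phi>p v"
    by (intro stiff_lincomb_right u v PP0_PP[OF \<phi>p] f; assumption)
  show ?thesis unfolding residual_def 1 2 3 4 5 by (simp add: algebra_simps)
qed

lemma mass_residual_lincomb:
  assumes \<phi>: "\<phi> \<in> PP 2" and \<mu>: "\<mu> \<in> PP 1" and u: "u \<in> PP 1" and v: "v \<in> PP 1"
    and f: "\<And>x. x \<in> C \<Longrightarrow> f x = a * u x + b * v x"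
  shows "mass_residual \<phi> \<mu> f = a * mass_residual \<phi> \<mu> u + b * mass_residual \<phi> \<mu> v"
proof -
  have c: "continuous_on C (\<lambda>x. (\<phi> x - \<phi>p x) / \<tau>)"
    using \<tau> by (intro continuous_intros PP_cont[OF \<phi>] PP_cont[OF PP0_PP[OF \<phi>p]]) auto
  have 1: "mass (\<lambda>x. (\<phi> x - \<phi>p x) / \<tau>) f
     = a * mass (\<lambda>x. (\<phi> x - \<phi>p x) / \<tau>) u + b * mass (\<lambda>x. (\<phi> x - \<phi>p x) / \<tau>) v"
    by (intro mass_lincomb_right f PP_cont[OF u] PP_cont[OF v] c; assumption)
  have 2: "stiff \<mu> f = a * stiff \<mu> u + b * stiff \<mu> v"
    by (intro stiff_lincomb_right PP1_PP2 u v \<mu> f; assumption)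
  show ?thesis unfolding mass_residual_def 1 2 by (simp add: algebra_simps)
qed

lemma mass_increment:
  assumes \<phi>: "\<phi> \<in> PP 2" and w: "w \<in> PP k"
  shows "mass (\<lambda>x. (\<phi> x - \<phi>p x) / \<tau>) w = (1/\<tau>) * (mass \<phi> w - mass \<phi>p w)"
proof -
  have "mass (\<lambda>x. (\<phi> x - \<phi>p x) / \<tau>) w = (1/\<tau>) * mass \<phi> w + (- (1/\<tau>)) * mass \<phi>p w"
    by (intro mass_lincomb PP_cont[OF \<phi>] PP_cont[OF PP0_PP[OF \<phi>p]] PP_cont[OF w])
       (simp add: diff_divide_distrib)
  then show ?thesis by (simp add: algebra_simps)
qed

lemma mass_shift:
  assumes \<phi>: "\<phi> \<in> PP 2" and w: "w \<in> PP0 k"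
  shows "mass (\<lambda>x. \<phi> x + \<phi>bar) w = mass \<phi> w"
proof -
  have "mass (\<lambda>x. \<phi> x + \<phi>bar) w = 1 * mass \<phi> w + \<phi>bar * mass (\<lambda>_. 1) w"
    by (intro mass_lincomb PP_cont[OF \<phi>] PP_cont[OF PP0_PP[OF w]] continuous_intros) simp
  also have "mass (\<lambda>_. 1) w = 0" using PP0_mean[OF w] by (simp add: L2_ip_commute[of _ w])
  finally show ?thesis by simp
qed

text \<open>The second equation is solved for \<open>\<mu>\<close> first. In a family \<open>b\<^sub>j\<close> orthonormal for the stiffness form it
  prescribes the coordinates of \<open>\<mu>\<close>, namely \<open>g\<^sub>j = - (\<phi> - \<phi>p, b\<^sub>j) / \<tau>\<close>. Inserting this into the
  first equation leaves \<open>A \<phi> \<psi> + ((\<phi> + \<phi>bar)\<^sup>3, \<psi>) = l \<psi>\<close> with the symmetric positive definite form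
  \<open>A u v = a u v + (1 - \<epsilon>) (u, v) + 1/\<tau> (\<Sum>j. (u, b\<^sub>j) (v, b\<^sub>j))\<close>; its last term is the
  discrete negative norm that comes from eliminating \<open>\<mu>\<close>. In an \<open>A\<close>-orthonormal family this is the
  cubic system solved above. The term \<open>(\<phi>bar, \<psi>)\<close> is zero as \<open>\<psi>\<close> has mean zero.\<close>

lemma weak_solution_exists: "\<exists>\<phi> \<mu>. weak_solution \<phi> \<mu>"
proof -
  obtain P where P: "finite P" "P \<subseteq> C" "\<And>v. v \<in> PP 2 \<Longrightarrow> \<forall>p\<in>P. v p = 0 \<Longrightarrow> \<forall>x\<in>C. v x = 0"
    by (rule determining_points) blast
  have sbD: "sym_bilinear_on (PP0 1) (\<lambda>u v. stiff u v)"
    unfolding sym_bilinear_on_def functional_on_def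
    by (intro conjI ballI allI stiff_lincomb PP1_PP2 PP0_PP L2_ip_commute) auto
  obtain n :: nat and b where b: "\<And>i. i < n \<Longrightarrow> b i \<in> PP0 1"
    and bon: "\<And>i j. i < n \<Longrightarrow> j < n \<Longrightarrow> stiff (b i) (b j) = (if i = j then 1 else 0)"
    and bspan: "\<And>v. v \<in> PP0 1 \<Longrightarrow> \<exists>c. \<forall>x\<in>C. v x = (\<Sum>i<n. c i * b i x)"
  proof (rule orthonormal_spanning_family[OF P(1,2) PP0_lincomb_closed[of 1] sbD])
    show "stiff v v > 0" if "v \<in> PP0 1" "\<exists>x\<in>C. v x \<noteq> 0" for v
      using that stiff_positive by blast
    show "\<forall>x\<in>C. v x = 0" if "v \<in> PP0 1" "\<forall>p\<in>P. v p = 0" for v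
      using P(3)[OF PP1_PP2[OF PP0_PP[OF that(1)]] that(2)] .
  qed blast
  have bc: "continuous_on C (b j)" if "j < n" for j using PP_cont[OF PP0_PP[OF b[OF that]]] .
  define A where "A = (\<lambda>u v. a_IP \<T> \<alpha> u v + (1 - \<epsilon>) * mass u v
      + (1/\<tau>) * (\<Sum>j<n. mass u (b j) * mass v (b j)))"
  have Alin: "A (\<lambda>x. s * u x + t * v x) w = s * A u w + t * A v w"
    if "u \<in> PP 2" "v \<in> PP 2" "w \<in> PP 2" for u v w s t
  proof -
    have 1: "a_IP \<T> \<alpha> (\<lambda>x. s * u x + t * v x) w = s * a_IP \<T> \<alpha> u w + t * a_IP \<T> \<alpha> v w"
      by (intro a_IP_lincomb that) simp
    have 2: "mass (\<lambda>x. s * u x + t * v x) w = s * mass u w + t * mass v w"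
      by (intro mass_lincomb PP_cont[OF that(1)] PP_cont[OF that(2)] PP_cont[OF that(3)]) simp
    have 3: "(\<Sum>j<n. mass (\<lambda>x. s * u x + t * v x) (b j) * mass w (b j))
        = s * (\<Sum>j<n. mass u (b j) * mass w (b j)) + t * (\<Sum>j<n. mass v (b j) * mass w (b j))"
    proof (rule sum_lincomb)
      fix j assume "j \<in> {..<n}"
      then have "mass (\<lambda>x. s * u x + t * v x) (b j) = s * mass u (b j) + t * mass v (b j)"
        by (intro mass_lincomb PP_cont[OF that(1)] PP_cont[OF that(2)] bc) auto
      then show "mass (\<lambda>x. s * u x + t * v x) (b j) * mass w (b j)
          = s * (mass u (b j) * mass w (b j)) + t * (mass v (b j) * mass w (b j))"
        by (simp add: algebra_simps)
    qed
    show ?thesis unfolding A_def 1 2 3 by (simp add: algebra_simps)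
  qed
  have sbA: "sym_bilinear_on (PP0 2) A"
    unfolding sym_bilinear_on_def functional_on_def
  proof (intro conjI ballI allI Alin PP0_PP)
    show "A u v = A v u" for u v
      unfolding A_def by (simp add: a_IP_commute[of _ u] L2_ip_commute[of _ u v] mult.commute[of "mass u _"])
  qed
  have Apos: "A v v > 0" if v: "v \<in> PP0 2" and x: "\<exists>x\<in>C. v x \<noteq> 0" for v
  proof -
    have "mass v v > 0" using x mass_definite[OF PP_cont[OF PP0_PP[OF v]]] by blast
    then have "(1 - \<epsilon>) * mass v v > 0" using \<epsilon> by simp
    moreover have "(1/\<tau>) * (\<Sum>j<n. mass v (b j) * mass v (b j)) \<ge> 0"
      using \<tau> by (simp add: sum_nonneg)
    ultimately show ?thesis using a_nonneg[OF PP0_PP[OF v]] by (simp add: A_def)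
  qed
  obtain m :: nat and e where e: "\<And>i. i < m \<Longrightarrow> e i \<in> PP0 2"
    and eon: "\<And>i j. i < m \<Longrightarrow> j < m \<Longrightarrow> A (e i) (e j) = (if i = j then 1 else 0)"
    and espan: "\<And>v. v \<in> PP0 2 \<Longrightarrow> \<exists>c. \<forall>x\<in>C. v x = (\<Sum>i<m. c i * e i x)"
  proof (rule orthonormal_spanning_family[OF P(1,2) PP0_lincomb_closed[of 2] sbA Apos])
    show "\<forall>x\<in>C. v x = 0" if "v \<in> PP0 2" "\<forall>p\<in>P. v p = 0" for v
      using P(3)[OF PP0_PP[OF that(1)] that(2)] .
  qed blast+
  have ec: "continuous_on C (e i)" if "i < m" for i using PP_cont[OF PP0_PP[OF e[OF that]]] .
  define l where "l = (\<lambda>i. 2 * stiff \<phi>p (e i) + (1/\<tau>) * (\<Sum>j<n. mass \<phi>p (b j) * mass (e i) (b j)))"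
  obtain c where c: "\<And>i. i < m \<Longrightarrow>
      c i + (LINT x:\<Omega>|lebesgue. ((\<Sum>i<m. c i * e i x) + \<phi>bar) ^ 3 * e i x) = l i"
    using cubic_system_solvable[where n = m and e = e and b = \<phi>bar and l = l,
        OF compact_C closure_subset domain_sets] ec by blast
  define \<phi> where "\<phi> = (\<lambda>x. \<Sum>i<m. c i * e i x)"
  have \<phi>: "\<phi> \<in> PP0 2" unfolding \<phi>_def using lincomb_closed_sum[OF PP0_lincomb_closed e] .
  define g where "g = (\<lambda>j. - (1/\<tau>) * (mass \<phi> (b j) - mass \<phi>p (b j)))"
  define \<mu> where "\<mu> = (\<lambda>x. \<Sum>j<n. g j * b j x)"
  have \<mu>: "\<mu> \<in> PP0 1" unfolding \<mu>_def using lincomb_closed_sum[OF PP0_lincomb_closed b] .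
  have A\<phi>: "A \<phi> (e i) = c i" if i: "i < m" for i
  proof -
    have "functional_on (PP0 2) (\<lambda>u. A u (e i))" using sbA e[OF i] by (simp add: sym_bilinear_on_def)
    from functional_on_sum[where n = m and c = c and e = e, OF PP0_lincomb_closed this] e
    have "A \<phi> (e i) = (\<Sum>j<m. c j * A (e j) (e i))" by (simp add: \<phi>_def)
    also have "\<dots> = (\<Sum>j<m. if j = i then c j else 0)"
      using eon i by (intro sum.cong) auto
    finally show ?thesis using i by simp
  qed
  have D\<mu>: "stiff \<mu> (b i) = g i" if i: "i < n" for i
  proof -
    have "functional_on (PP0 1) (\<lambda>u. stiff u (b i))" using sbD b[OF i] by (simp add: sym_bilinear_on_def)
    from functional_on_sum[where n = n and c = g and e = b, OF PP0_lincomb_closed this] b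
    have "stiff \<mu> (b i) = (\<Sum>j<n. g j * stiff (b j) (b i))" by (simp add: \<mu>_def)
    also have "\<dots> = (\<Sum>j<n. if j = i then g j else 0)"
      using bon i by (intro sum.cong) auto
    finally show ?thesis using i by simp
  qed
  have M\<mu>: "mass \<mu> (e i) = (\<Sum>j<n. g j * mass (b j) (e i))" if i: "i < m" for i
  proof -
    have "functional_on (PP0 1) (\<lambda>u. mass u (e i))" unfolding functional_on_def
      by (intro ballI allI mass_lincomb PP_cont[OF PP0_PP] ec[OF i]) auto
    from functional_on_sum[where n = n and c = g and e = b, OF PP0_lincomb_closed this] b show ?thesis by (simp add: \<mu>_def)
  qed
  have R1: "residual \<phi> \<mu> (e i) = 0" if i: "i < m" for i
  proof -
    have 1: "mass \<mu> (e i) = - (1/\<tau>) * (\<Sum>j<n. mass \<phi> (b j) * mass (e i) (b j))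
        + (1/\<tau>) * (\<Sum>j<n. mass \<phi>p (b j) * mass (e i) (b j))"
      unfolding M\<mu>[OF i]
      by (rule sum_lincomb) (simp add: g_def L2_ip_commute[of _ _ "e i"] algebra_simps)
    have 2: "mass (\<lambda>x. (\<phi> x + \<phi>bar) ^ 3) (e i) = l i - c i"
      using c[OF i] by (simp add: L2_ip_def \<phi>_def)
    have 3: "a_IP \<T> \<alpha> \<phi> (e i) = c i - (1 - \<epsilon>) * mass \<phi> (e i)
        - (1/\<tau>) * (\<Sum>j<n. mass \<phi> (b j) * mass (e i) (b j))"
      using A\<phi>[OF i] by (simp add: A_def)
    show ?thesis
      unfolding residual_def 1 2 3 mass_shift[OF PP0_PP[OF \<phi>] e[OF i]] l_def by simp
  qed
  have R2: "mass_residual \<phi> \<mu> (b j) = 0" if j: "j < n" for j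
    unfolding mass_residual_def mass_increment[OF PP0_PP[OF \<phi>] PP0_PP[OF b[OF j]]] D\<mu>[OF j] g_def
    by simp
  have "residual \<phi> \<mu> \<psi> = 0" if \<psi>: "\<psi> \<in> PP0 2" for \<psi>
  proof -
    obtain d where d: "\<forall>x\<in>C. \<psi> x = (\<Sum>i<m. d i * e i x)" using espan[OF \<psi>] by blast
    show ?thesis
    proof (rule functional_zero_on_span[where L = "residual \<phi> \<mu>", OF PP0_lincomb_closed _ _ _ d])
      show "residual \<phi> \<mu> f = s * residual \<phi> \<mu> u + t * residual \<phi> \<mu> v"
        if "u \<in> PP0 2" "v \<in> PP0 2" "\<And>x. x \<in> C \<Longrightarrow> f x = s * u x + t * v x" for u v f s t
        using residual_lincomb[OF PP0_PP[OF \<phi>] PP0_PP[OF \<mu>] PP0_PP[OF that(1)] PP0_PP[OF that(2)]] that(3) .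
    qed (use e R1 in auto)
  qed
  moreover have "mass_residual \<phi> \<mu> \<nu> = 0" if \<nu>: "\<nu> \<in> PP0 1" for \<nu>
  proof -
    obtain d where d: "\<forall>x\<in>C. \<nu> x = (\<Sum>i<n. d i * b i x)" using bspan[OF \<nu>] by blast
    show ?thesis
    proof (rule functional_zero_on_span[where L = "mass_residual \<phi> \<mu>", OF PP0_lincomb_closed _ _ _ d])
      show "mass_residual \<phi> \<mu> f = s * mass_residual \<phi> \<mu> u + t * mass_residual \<phi> \<mu> v"
        if "u \<in> PP0 1" "v \<in> PP0 1" "\<And>x. x \<in> C \<Longrightarrow> f x = s * u x + t * v x" for u v f s t
        using mass_residual_lincomb[OF PP0_PP[OF \<phi>] PP0_PP[OF \<mu>] PP0_PP[OF that(1)] PP0_PP[OF that(2)]] that(3) .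
    qed (use b R2 in auto)
  qed
  ultimately show ?thesis using \<phi> \<mu> unfolding weak_solution_def by blast
qed

text \<open>Test the difference of the first equations with \<open>\<delta> = \<phi>\<^sub>1 - \<phi>\<^sub>2\<close> and that of the second ones with
  \<open>\<eta> = \<mu>\<^sub>1 - \<mu>\<^sub>2\<close>. The mixed terms \<open>(\<eta>, \<delta>)\<close> combine to
  \<open>a \<delta> \<delta> + (q\<^sub>1\<^sup>3 - q\<^sub>2\<^sup>3, \<delta>) + (1 - \<epsilon>) (\<delta>, \<delta>) + \<tau> (\<nabla>\<eta>, \<nabla>\<eta>) = 0\<close>
  with \<open>q\<^sub>i = \<phi>\<^sub>i + \<phi>bar\<close>, where every term is nonnegative because the cube is monotone. Thus
  \<open>\<delta> = 0\<close>; then \<open>\<eta>\<close> has zero stiffness energy and mean zero.\<close>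

lemma weak_solution_unique:
  assumes 1: "weak_solution \<phi>1 \<mu>1" and 2: "weak_solution \<phi>2 \<mu>2" and x: "x \<in> C"
  shows "\<phi>1 x = \<phi>2 x" "\<mu>1 x = \<mu>2 x"
proof -
  have P: "\<phi>1 \<in> PP0 2" "\<phi>2 \<in> PP0 2" "\<mu>1 \<in> PP0 1" "\<mu>2 \<in> PP0 1"
    using 1 2 by (auto simp: weak_solution_def)
  define \<delta> where "\<delta> = (\<lambda>x. \<phi>1 x - \<phi>2 x)"
  define \<eta> where "\<eta> = (\<lambda>x. \<mu>1 x - \<mu>2 x)"
  have \<delta>: "\<delta> \<in> PP0 2" by (rule PP0_lincomb[OF P(1,2), of _ 1 "-1"]) (simp add: \<delta>_def)
  have \<eta>: "\<eta> \<in> PP0 1" by (rule PP0_lincomb[OF P(3,4), of _ 1 "-1"]) (simp add: \<eta>_def)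
  note PP = P[THEN PP0_PP] \<delta>[THEN PP0_PP] \<eta>[THEN PP0_PP]
  note c = PP[THEN PP_cont]
  have a: "a_IP \<T> \<alpha> \<delta> \<delta> = 1 * a_IP \<T> \<alpha> \<phi>1 \<delta> + (-1) * a_IP \<T> \<alpha> \<phi>2 \<delta>"
    by (rule a_IP_lincomb[OF PP(1,2,5)]) (simp add: \<delta>_def)
  have i: "mass \<delta> \<delta> = 1 * mass \<phi>1 \<delta> + (-1) * mass \<phi>2 \<delta>"
    by (rule mass_lincomb[OF _ c(1,2,5)]) (simp add: \<delta>_def)
  have m: "mass \<eta> \<delta> = 1 * mass \<mu>1 \<delta> + (-1) * mass \<mu>2 \<delta>"
    by (rule mass_lincomb[OF _ c(3,4,5)]) (simp add: \<eta>_def)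
  have d: "stiff \<eta> \<eta> = 1 * stiff \<mu>1 \<eta> + (-1) * stiff \<mu>2 \<eta>"
    by (rule stiff_lincomb[OF PP(3,4,6)[THEN PP1_PP2]]) (simp add: \<eta>_def)
  have i': "mass \<delta> \<eta> = 1 * mass \<phi>1 \<eta> + (-1) * mass \<phi>2 \<eta>"
    by (rule mass_lincomb[OF _ c(1,2,6)]) (simp add: \<delta>_def)
  have q: "mass (\<lambda>x. (\<phi>1 x + \<phi>bar) ^ 3 - (\<phi>2 x + \<phi>bar) ^ 3) \<delta>
     = 1 * mass (\<lambda>x. (\<phi>1 x + \<phi>bar) ^ 3) \<delta> + (-1) * mass (\<lambda>x. (\<phi>2 x + \<phi>bar) ^ 3) \<delta>"
    by (intro mass_lincomb continuous_intros c) simp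
  have q0: "mass (\<lambda>x. (\<phi>1 x + \<phi>bar) ^ 3 - (\<phi>2 x + \<phi>bar) ^ 3) \<delta> \<ge> 0"
  proof (rule mass_nonneg)
    fix x
    have "0 \<le> (s ^ 3 - t ^ 3) * (s - t)" for s t :: real
    proof -
      have "(s ^ 3 - t ^ 3) * (s - t) = (s - t)\<^sup>2 * ((s + t / 2)\<^sup>2 + 3/4 * t\<^sup>2)"
        by (simp add: field_simps power2_eq_square power3_eq_cube)
      then show ?thesis by simp
    qed
    from this[of "\<phi>1 x + \<phi>bar" "\<phi>2 x + \<phi>bar"]
    show "0 \<le> ((\<phi>1 x + \<phi>bar) ^ 3 - (\<phi>2 x + \<phi>bar) ^ 3) * \<delta> x" by (simp add: \<delta>_def)
  qed
  have "residual \<phi>1 \<mu>1 \<delta> = 0" "residual \<phi>2 \<mu>2 \<delta> = 0"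
    using 1 2 \<delta> by (auto simp: weak_solution_def)
  then have "a_IP \<T> \<alpha> \<delta> \<delta> + mass (\<lambda>x. (\<phi>1 x + \<phi>bar) ^ 3 - (\<phi>2 x + \<phi>bar) ^ 3) \<delta>
      + (1 - \<epsilon>) * mass \<delta> \<delta> - mass \<eta> \<delta> = 0"
    unfolding residual_def mass_shift[OF PP(1) \<delta>] mass_shift[OF PP(2) \<delta>] a i m q
    by (simp add: algebra_simps)
  moreover have "mass_residual \<phi>1 \<mu>1 \<eta> = 0" "mass_residual \<phi>2 \<mu>2 \<eta> = 0"
    using 1 2 \<eta> by (auto simp: weak_solution_def)
  then have "(1/\<tau>) * mass \<delta> \<eta> + stiff \<eta> \<eta> = 0"
    unfolding mass_residual_def mass_increment[OF PP(1) PP(6)] mass_increment[OF PP(2) PP(6)] i' d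
    by (simp add: algebra_simps)
  then have D: "mass \<delta> \<eta> = - \<tau> * stiff \<eta> \<eta>" using \<tau> by (simp add: field_simps)
  moreover have "mass \<eta> \<delta> = mass \<delta> \<eta>" by (rule L2_ip_commute)
  moreover have "\<tau> * stiff \<eta> \<eta> \<ge> 0" using \<tau> stiff_nonneg[of \<eta>] by simp
  ultimately have le: "(1 - \<epsilon>) * mass \<delta> \<delta> \<le> 0" using a_nonneg[OF PP(5)] q0 by linarith
  have \<delta>0: "\<delta> y = 0" if "y \<in> C" for y
  proof (rule ccontr)
    assume "\<delta> y \<noteq> 0"
    then have "(1 - \<epsilon>) * mass \<delta> \<delta> > 0" using mass_definite[OF c(5) that] \<epsilon> by simp
    with le show False by simp
  qed
  have "mass \<delta> \<eta> = mass (\<lambda>_. 0) \<eta>" by (rule mass_cong) (use \<delta>0 in auto)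
  also have "\<dots> = 0" by (simp add: L2_ip_def set_lebesgue_integral_def)
  finally have "stiff \<eta> \<eta> = 0" using D \<tau> by simp
  then have "\<eta> x = 0" using stiff_positive[OF \<eta> x] by fastforce
  with \<delta>0[OF x] show "\<phi>1 x = \<phi>2 x" "\<mu>1 x = \<mu>2 x" by (simp_all add: \<delta>_def \<eta>_def)
qed

section \<open>The correspondence of the two problems\<close>

lemma solutions_A_iff:
  "(\<phi>, \<mu>) \<in> solutions_A \<Omega> \<T> \<alpha> \<epsilon> \<tau> \<phi>bar \<phi>p \<longleftrightarrow>
     \<phi> \<in> extensional C \<and> \<mu> \<in> extensional C \<and> weak_solution \<phi> \<mu>" (is "?L \<longleftrightarrow> ?R")
proof -
  have L: "?L \<longleftrightarrow> \<phi> \<in> PP0 2 \<inter> extensional C \<and> \<mu> \<in> PP0 1 \<inter> extensional C \<and>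
    (\<forall>\<psi>\<in>PP0 2 \<inter> extensional C. residual \<phi> \<mu> \<psi> = 0) \<and>
    (\<forall>\<nu>\<in>PP0 1 \<inter> extensional C. mass_residual \<phi> \<mu> \<nu> = 0)"
  proof -
    have 1: "(s = - t) = (t + s = 0)" for s t :: real by linarith
    show ?thesis
      unfolding solutions_A_def Zh0_def Vh0_def Zh_def Vh_def FE_space_zero_mean
        residual_def mass_residual_def 1 by simp
  qed
  have r: "residual \<phi> \<mu> \<psi> = residual \<phi> \<mu> (restrict \<psi> C)" 
    if "\<phi> \<in> PP0 2" "\<mu> \<in> PP0 1" "\<psi> \<in> PP0 2" for \<psi>
    using residual_lincomb[OF PP0_PP[OF that(1)] PP0_PP[OF that(2)] PP0_PP[OF that(3)] PP0_PP[OF that(3)],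
        of "restrict \<psi> C" 1 0] by simp
  have s: "mass_residual \<phi> \<mu> \<nu> = mass_residual \<phi> \<mu> (restrict \<nu> C)" 
    if "\<phi> \<in> PP0 2" "\<mu> \<in> PP0 1" "\<nu> \<in> PP0 1" for \<nu>
    using mass_residual_lincomb[OF PP0_PP[OF that(1)] PP0_PP[OF that(2)] PP0_PP[OF that(3)] PP0_PP[OF that(3)],
        of "restrict \<nu> C" 1 0] by simp
  show ?thesis
  proof
    assume ?R
    then show ?L unfolding L weak_solution_def by blast
  next
    assume ?L
    then have l: "\<phi> \<in> PP0 2" "\<mu> \<in> PP0 1" "\<phi> \<in> extensional C" "\<mu> \<in> extensional C"
      "\<forall>\<psi>\<in>PP0 2 \<inter> extensional C. residual \<phi> \<mu> \<psi> = 0"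
      "\<forall>\<nu>\<in>PP0 1 \<inter> extensional C. mass_residual \<phi> \<mu> \<nu> = 0" unfolding L by blast+
    have "residual \<phi> \<mu> \<psi> = 0" if "\<psi> \<in> PP0 2" for \<psi>
      unfolding r[OF l(1,2) that] using l(5) PP0_restrict[OF that] by simp
    moreover have "mass_residual \<phi> \<mu> \<nu> = 0" if "\<nu> \<in> PP0 1" for \<nu>
      unfolding s[OF l(1,2) that] using l(6) PP0_restrict[OF that] by simp
    ultimately show ?R using l unfolding weak_solution_def by blast
  qed
qed

lemma solutions_A_ex1: "\<exists>!s. s \<in> solutions_A \<Omega> \<T> \<alpha> \<epsilon> \<tau> \<phi>bar \<phi>p"
proof -
  obtain \<phi> \<mu> where w: "weak_solution \<phi> \<mu>" using weak_solution_exists by blast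
  then have P: "\<phi> \<in> PP0 2" "\<mu> \<in> PP0 1" by (auto simp: weak_solution_def)
  show ?thesis
  proof (rule ex1I[of _ "(restrict \<phi> C, restrict \<mu> C)"])
    have restricted: "mass (\<lambda>x. (restrict \<phi> C x + \<phi>bar) ^ 3) \<psi> = mass (\<lambda>x. (\<phi> x + \<phi>bar) ^ 3) \<psi>"
      "mass (\<lambda>x. restrict \<phi> C x + \<phi>bar) \<psi> = mass (\<lambda>x. \<phi> x + \<phi>bar) \<psi>"
      "mass (restrict \<mu> C) \<psi> = mass \<mu> \<psi>"
      "mass (\<lambda>x. (restrict \<phi> C x - \<phi>p x) / \<tau>) \<psi> = mass (\<lambda>x. (\<phi> x - \<phi>p x) / \<tau>) \<psi>" for \<psi>
      by (rule mass_cong; simp)+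
    have a: "a_IP \<T> \<alpha> (restrict \<phi> C) \<psi> = a_IP \<T> \<alpha> \<phi> \<psi>" if "\<psi> \<in> PP0 2" for \<psi>
      using a_IP_lincomb[OF PP0_PP[OF P(1)] PP0_PP[OF P(1)] PP0_PP[OF that], of "restrict \<phi> C" 1 0] by simp
    have d: "stiff (restrict \<mu> C) \<nu> = stiff \<mu> \<nu>" if "\<nu> \<in> PP0 1" for \<nu>
      using stiff_lincomb[OF P(2)[THEN PP0_PP, THEN PP1_PP2] P(2)[THEN PP0_PP, THEN PP1_PP2]
          that[THEN PP0_PP, THEN PP1_PP2], of "restrict \<mu> C" 1 0] by simp
    have "weak_solution (restrict \<phi> C) (restrict \<mu> C)"
      using w PP0_restrict unfolding weak_solution_def residual_def mass_residual_def restricted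
      by (simp add: a d)
    then show "(restrict \<phi> C, restrict \<mu> C) \<in> solutions_A \<Omega> \<T> \<alpha> \<epsilon> \<tau> \<phi>bar \<phi>p"
      unfolding solutions_A_iff by simp
    fix s assume s: "s \<in> solutions_A \<Omega> \<T> \<alpha> \<epsilon> \<tau> \<phi>bar \<phi>p"
    obtain \<phi>' \<mu>' where s': "s = (\<phi>', \<mu>')" by fastforce
    then have 1: "\<phi>' \<in> extensional C" "\<mu>' \<in> extensional C" "weak_solution \<phi>' \<mu>'"
      using s solutions_A_iff by auto
    have "\<phi>' = restrict \<phi> C" "\<mu>' = restrict \<mu> C"
      using weak_solution_unique[OF 1(3) w] 1(1,2) by (auto intro!: extensionalityI)
    then show "s = (restrict \<phi> C, restrict \<mu> C)" using s' by simp
  qed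
qed

definition mu_shift :: "(real^2 \<Rightarrow> real) \<Rightarrow> real" where
  "mu_shift \<phi> = 1 / measure lebesgue \<Omega> * mass (\<lambda>x. (\<phi> x + \<phi>bar) ^ 3) (\<lambda>x. 1) + (1 - \<epsilon>) * \<phi>bar"

lemma mu_shift_measure:
  "mu_shift \<phi> * measure lebesgue \<Omega>
    = mass (\<lambda>x. (\<phi> x + \<phi>bar) ^ 3) (\<lambda>_. 1) + (1 - \<epsilon>) * \<phi>bar * measure lebesgue \<Omega>"
  using measure_domain(1) by (simp add: mu_shift_def distrib_right)

text \<open>The residual of the problem without mean constraints, tested with \<open>\<psi>0 + c\<close>, is the residual of the
  problem with mean zero tested with \<open>\<psi>0\<close>. Constants are in the kernel of the interior penalty and the
  stiffness form, so \<open>c\<close> enters through the mass terms alone. The constant added to \<open>\<mu>\<close> is the one for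
  which these cancel.\<close>

lemma residual_shift:
  assumes \<phi>: "\<phi> \<in> PP0 2" and \<mu>: "\<mu> \<in> PP0 1" and \<psi>: "\<psi> \<in> PP 2" and \<psi>0: "\<psi>0 \<in> PP0 2"
    and \<Phi>: "\<And>x. x \<in> C \<Longrightarrow> \<Phi> x = \<phi> x + \<phi>bar" and M: "\<And>x. x \<in> C \<Longrightarrow> M x = \<mu> x + mu_shift \<phi>"
    and prev: "\<And>x. x \<in> C \<Longrightarrow> \<phi>prev x = \<phi>p x + \<phi>bar" and dec: "\<And>x. x \<in> C \<Longrightarrow> \<psi> x = \<psi>0 x + c"
  shows "a_IP \<T> \<alpha> \<Phi> \<psi> + mass (\<lambda>x. (\<Phi> x) ^ 3 + (1 - \<epsilon>) * \<Phi> x) \<psi>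
           - 2 * stiff \<phi>prev \<psi> - mass M \<psi> = residual \<phi> \<mu> \<psi>0"
proof -
  note one = PP_const[of 1 2]
  note P = \<phi>[THEN PP0_PP] \<mu>[THEN PP0_PP] \<psi>0[THEN PP0_PP] \<phi>p[THEN PP0_PP]
  note c = P[THEN PP_cont] PP_cont[OF \<psi>]
  have "a_IP \<T> \<alpha> \<Phi> \<psi> = 1 * a_IP \<T> \<alpha> \<phi> \<psi> + \<phi>bar * a_IP \<T> \<alpha> (\<lambda>_. 1) \<psi>"
    by (rule a_IP_lincomb[OF P(1) one \<psi>]) (simp add: \<Phi>)
  moreover have "a_IP \<T> \<alpha> \<phi> \<psi> = 1 * a_IP \<T> \<alpha> \<phi> \<psi>0 + c * a_IP \<T> \<alpha> \<phi> (\<lambda>_. 1)"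
    by (rule a_IP_lincomb_right[OF P(3) one P(1)]) (simp add: dec)
  ultimately have a: "a_IP \<T> \<alpha> \<Phi> \<psi> = a_IP \<T> \<alpha> \<phi> \<psi>0"
    using a_IP_const[OF \<psi>, of \<alpha> 1] a_IP_const_right[OF P(1), of \<alpha> 1] by simp
  have "stiff \<phi>prev \<psi> = 1 * stiff \<phi>p \<psi> + \<phi>bar * stiff (\<lambda>_. 1) \<psi>"
    by (rule stiff_lincomb[OF P(4) one \<psi>]) (simp add: prev)
  moreover have "stiff \<phi>p \<psi> = 1 * stiff \<phi>p \<psi>0 + c * stiff \<phi>p (\<lambda>_. 1)"
    by (rule stiff_lincomb_right[OF P(3) one P(4)]) (simp add: dec)
  ultimately have d: "stiff \<phi>prev \<psi> = stiff \<phi>p \<psi>0"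
    using stiff_const[OF \<psi>, of 1] stiff_const_right[OF P(4), of 1] by simp
  have split: "mass g \<psi> = mass g \<psi>0 + c * mass g (\<lambda>_. 1)" if "continuous_on C g" for g
    using mass_lincomb_right[of \<psi> 1 \<psi>0 c "\<lambda>_. 1" g] dec c(3) that by simp
  have cq: "continuous_on C (\<lambda>x. (\<phi> x + \<phi>bar) ^ 3)" "continuous_on C (\<lambda>x. \<phi> x + \<phi>bar)"
    by (intro continuous_intros c)+
  have "mass (\<lambda>x. (\<Phi> x) ^ 3 + (1 - \<epsilon>) * \<Phi> x) \<psi>
      = 1 * mass (\<lambda>x. (\<phi> x + \<phi>bar) ^ 3) \<psi> + (1 - \<epsilon>) * mass (\<lambda>x. \<phi> x + \<phi>bar) \<psi>"
    by (rule mass_lincomb[OF _ cq c(5)]) (simp add: \<Phi>)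
  also have "\<dots> = mass (\<lambda>x. (\<phi> x + \<phi>bar) ^ 3) \<psi>0 + c * mass (\<lambda>x. (\<phi> x + \<phi>bar) ^ 3) (\<lambda>_. 1)
      + (1 - \<epsilon>) * (mass (\<lambda>x. \<phi> x + \<phi>bar) \<psi>0 + c * mass (\<lambda>x. \<phi> x + \<phi>bar) (\<lambda>_. 1))"
    by (simp add: split[OF cq(1)] split[OF cq(2)])
  also have "mass (\<lambda>x. \<phi> x + \<phi>bar) (\<lambda>_. 1) = 1 * mass \<phi> (\<lambda>_. 1) + \<phi>bar * mass (\<lambda>_. 1 :: real) (\<lambda>_. 1)"
    by (rule mass_lincomb[OF _ c(1)]) auto
  also have "\<dots> = \<phi>bar * measure lebesgue \<Omega>" using PP0_mean[OF \<phi>] mass_one[of 1] by simp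
  finally have q: "mass (\<lambda>x. (\<Phi> x) ^ 3 + (1 - \<epsilon>) * \<Phi> x) \<psi>
     = mass (\<lambda>x. (\<phi> x + \<phi>bar) ^ 3) \<psi>0 + (1 - \<epsilon>) * mass (\<lambda>x. \<phi> x + \<phi>bar) \<psi>0
       + c * (mass (\<lambda>x. (\<phi> x + \<phi>bar) ^ 3) (\<lambda>_. 1) + (1 - \<epsilon>) * \<phi>bar * measure lebesgue \<Omega>)"
    by (simp add: algebra_simps)
  have "mass M \<psi> = 1 * mass \<mu> \<psi> + mu_shift \<phi> * mass (\<lambda>_. 1) \<psi>"
    by (rule mass_lincomb[OF _ c(2) _ c(5)]) (auto simp: M)
  also have "mass \<mu> \<psi> = mass \<mu> \<psi>0" using split[OF c(2)] PP0_mean[OF \<mu>] by simp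
  also have "mass (\<lambda>_. 1) \<psi> = c * measure lebesgue \<Omega>"
    using split[of "\<lambda>_. 1"] PP0_mean[OF \<psi>0] mass_one[of 1] by (simp add: L2_ip_commute[of _ "\<lambda>_. 1" \<psi>0])
  also have "mu_shift \<phi> * (c * measure lebesgue \<Omega>)
    = c * (mass (\<lambda>x. (\<phi> x + \<phi>bar) ^ 3) (\<lambda>_. 1) + (1 - \<epsilon>) * \<phi>bar * measure lebesgue \<Omega>)"
    using mu_shift_measure[of \<phi>] by (simp add: mult.left_commute)
  finally have m: "mass M \<psi> = mass \<mu> \<psi>0
      + c * (mass (\<lambda>x. (\<phi> x + \<phi>bar) ^ 3) (\<lambda>_. 1) + (1 - \<epsilon>) * \<phi>bar * measure lebesgue \<Omega>)" by simp
  show ?thesis unfolding a d q m residual_def by simp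
qed

lemma mass_residual_shift:
  assumes \<phi>: "\<phi> \<in> PP0 2" and \<mu>: "\<mu> \<in> PP0 1" and \<nu>: "\<nu> \<in> PP 1" and \<nu>0: "\<nu>0 \<in> PP0 1"
    and \<Phi>: "\<And>x. x \<in> C \<Longrightarrow> \<Phi> x = \<phi> x + \<phi>bar" and M: "\<And>x. x \<in> C \<Longrightarrow> M x = \<mu> x + m"
    and prev: "\<And>x. x \<in> C \<Longrightarrow> \<phi>prev x = \<phi>p x + \<phi>bar" and dec: "\<And>x. x \<in> C \<Longrightarrow> \<nu> x = \<nu>0 x + c"
  shows "mass (\<lambda>x. (\<Phi> x - \<phi>prev x) / \<tau>) \<nu> + stiff M \<nu> = mass_residual \<phi> \<mu> \<nu>0"
proof -
  note one = PP_const[of 1 2]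
  note P = \<phi>[THEN PP0_PP] \<mu>[THEN PP0_PP, THEN PP1_PP2] \<nu>0[THEN PP0_PP, THEN PP1_PP2]
    \<phi>p[THEN PP0_PP] PP1_PP2[OF \<nu>]
  note c = P[THEN PP_cont]
  have "mass (\<lambda>x. (\<Phi> x - \<phi>prev x) / \<tau>) \<nu> = mass (\<lambda>x. (\<phi> x - \<phi>p x) / \<tau>) \<nu>"
    by (rule mass_cong) (simp_all add: \<Phi> prev)
  also have "\<dots> = (1/\<tau>) * (mass \<phi> \<nu> - mass \<phi>p \<nu>)" by (rule mass_increment[OF P(1,5)])
  also have "mass \<phi> \<nu> = 1 * mass \<phi> \<nu>0 + c * mass \<phi> (\<lambda>_. 1)"
    by (rule mass_lincomb_right[OF _ c(3) _ c(1)]) (auto simp: dec)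
  also have "mass \<phi>p \<nu> = 1 * mass \<phi>p \<nu>0 + c * mass \<phi>p (\<lambda>_. 1)"
    by (rule mass_lincomb_right[OF _ c(3) _ c(4)]) (auto simp: dec)
  finally have 1: "mass (\<lambda>x. (\<Phi> x - \<phi>prev x) / \<tau>) \<nu> = (1/\<tau>) * (mass \<phi> \<nu>0 - mass \<phi>p \<nu>0)"
    using PP0_mean[OF \<phi>] PP0_mean[OF \<phi>p] by simp
  have "stiff M \<nu> = 1 * stiff \<mu> \<nu> + m * stiff (\<lambda>_. 1) \<nu>"
    by (rule stiff_lincomb[OF P(2) one P(5)]) (simp add: M)
  moreover have "stiff \<mu> \<nu> = 1 * stiff \<mu> \<nu>0 + c * stiff \<mu> (\<lambda>_. 1)"
    by (rule stiff_lincomb_right[OF P(3) one P(2)]) (simp add: dec)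
  ultimately have 2: "stiff M \<nu> = stiff \<mu> \<nu>0"
    using stiff_const[OF P(5), of 1] stiff_const_right[OF P(2), of 1] by simp
  show ?thesis unfolding 1 2 mass_residual_def mass_increment[OF P(1,3)] ..
qed

lemma A_to_B_eq: "A_to_B \<Omega> \<epsilon> \<phi>bar (\<phi>, \<mu>) = (\<lambda>x\<in>C. \<phi> x + \<phi>bar, \<lambda>x\<in>C. \<mu> x + mu_shift \<phi>)"
  by (simp add: A_to_B_def mu_shift_def add.assoc)

lemma solutions_A_iff_B:
  assumes \<phi>: "\<phi> \<in> PP0 2" "\<phi> \<in> extensional C" and \<mu>: "\<mu> \<in> PP0 1" "\<mu> \<in> extensional C"
    and prev: "\<And>x. x \<in> C \<Longrightarrow> \<phi>prev x = \<phi>p x + \<phi>bar"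
  shows "(\<phi>, \<mu>) \<in> solutions_A \<Omega> \<T> \<alpha> \<epsilon> \<tau> \<phi>bar \<phi>p \<longleftrightarrow>
    A_to_B \<Omega> \<epsilon> \<phi>bar (\<phi>, \<mu>) \<in> solutions_B \<Omega> \<T> \<alpha> \<epsilon> \<tau> \<phi>prev" (is "?A \<longleftrightarrow> ?B")
proof -
  let ?\<Phi> = "\<lambda>x\<in>C. \<phi> x + \<phi>bar" and ?M = "\<lambda>x\<in>C. \<mu> x + mu_shift \<phi>"
  let ?R = "\<lambda>\<psi>. a_IP \<T> \<alpha> ?\<Phi> \<psi> + mass (\<lambda>x. (?\<Phi> x) ^ 3 + (1 - \<epsilon>) * ?\<Phi> x) \<psi>
           - 2 * stiff \<phi>prev \<psi> - mass ?M \<psi>"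
  let ?S = "\<lambda>\<nu>. mass (\<lambda>x. (?\<Phi> x - \<phi>prev x) / \<tau>) \<nu> + stiff ?M \<nu>"
  have \<Phi>P: "?\<Phi> \<in> PP 2" by (intro PP_restrict PP_shift PP0_PP \<phi>)
  have MP: "?M \<in> PP 1" by (intro PP_restrict PP_shift PP0_PP \<mu>)
  have R: "?R \<psi> = residual \<phi> \<mu> \<psi>0"
    if "\<psi> \<in> PP 2" "\<psi>0 \<in> PP0 2" "\<And>x. x \<in> C \<Longrightarrow> \<psi> x = \<psi>0 x + c" for \<psi> \<psi>0 c
    by (rule residual_shift[OF \<phi>(1) \<mu>(1) that(1,2) _ _ prev that(3)]) auto
  have S: "?S \<nu> = mass_residual \<phi> \<mu> \<nu>0"
    if "\<nu> \<in> PP 1" "\<nu>0 \<in> PP0 1" "\<And>x. x \<in> C \<Longrightarrow> \<nu> x = \<nu>0 x + c" for \<nu> \<nu>0 c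
    by (rule mass_residual_shift[OF \<phi>(1) \<mu>(1) that(1,2) _ _ prev that(3)]) auto
  have B: "?B \<longleftrightarrow> (\<forall>\<nu>\<in>PP 1 \<inter> extensional C. ?S \<nu> = 0) \<and> (\<forall>\<psi>\<in>PP 2 \<inter> extensional C. ?R \<psi> = 0)"
    unfolding A_to_B_eq solutions_B_def Zh_def Vh_def FE_space_eq using \<Phi>P MP by simp
  have A: "?A \<longleftrightarrow> (\<forall>\<psi>\<in>PP0 2. residual \<phi> \<mu> \<psi> = 0) \<and> (\<forall>\<nu>\<in>PP0 1. mass_residual \<phi> \<mu> \<nu> = 0)"
    unfolding solutions_A_iff weak_solution_def using \<phi> \<mu> by simp
  show ?thesis
  proof
    assume ?A
    then have r: "\<And>\<psi>. \<psi> \<in> PP0 2 \<Longrightarrow> residual \<phi> \<mu> \<psi> = 0" "\<And>\<nu>. \<nu> \<in> PP0 1 \<Longrightarrow> mass_residual \<phi> \<mu> \<nu> = 0"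
      unfolding A by auto
    show ?B unfolding B
    proof (intro conjI ballI)
      fix \<psi> assume "\<psi> \<in> PP 2 \<inter> extensional C"
      then have \<psi>: "\<psi> \<in> PP 2" by blast
      obtain c \<psi>0 where d: "\<psi>0 \<in> PP0 2" "\<And>x. x \<in> C \<Longrightarrow> \<psi> x = \<psi>0 x + c"
        using zero_mean_decomposition[OF \<psi>] by metis
      show "?R \<psi> = 0" using R[OF \<psi> d] r(1)[OF d(1)] by (rule trans)
    next
      fix \<nu> assume "\<nu> \<in> PP 1 \<inter> extensional C"
      then have \<nu>: "\<nu> \<in> PP 1" by blast
      obtain c \<nu>0 where d: "\<nu>0 \<in> PP0 1" "\<And>x. x \<in> C \<Longrightarrow> \<nu> x = \<nu>0 x + c"
        using zero_mean_decomposition[OF \<nu>] by metis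
      show "?S \<nu> = 0" using S[OF \<nu> d] r(2)[OF d(1)] by (rule trans)
    qed
  next
    assume ?B
    then have r: "\<And>\<nu>. \<nu> \<in> PP 1 \<Longrightarrow> \<nu> \<in> extensional C \<Longrightarrow> ?S \<nu> = 0"
      "\<And>\<psi>. \<psi> \<in> PP 2 \<Longrightarrow> \<psi> \<in> extensional C \<Longrightarrow> ?R \<psi> = 0"
      unfolding B by auto
    show ?A unfolding A
    proof (intro conjI ballI)
      fix \<psi> assume \<psi>: "\<psi> \<in> PP0 2"
      have "?R (restrict \<psi> C) = residual \<phi> \<mu> \<psi>"
        by (rule R[OF PP_restrict[OF PP0_PP[OF \<psi>]] \<psi>, of 0]) simp
      then show "residual \<phi> \<mu> \<psi> = 0"
        using r(2)[OF PP_restrict[OF PP0_PP[OF \<psi>]] restrict_extensional] by (rule trans[OF sym])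
    next
      fix \<nu> assume \<nu>: "\<nu> \<in> PP0 1"
      have "?S (restrict \<nu> C) = mass_residual \<phi> \<mu> \<nu>"
        by (rule S[OF PP_restrict[OF PP0_PP[OF \<nu>]] \<nu>, of 0]) simp
      then show "mass_residual \<phi> \<mu> \<nu> = 0"
        using r(1)[OF PP_restrict[OF PP0_PP[OF \<nu>]] restrict_extensional] by (rule trans[OF sym])
    qed
  qed
qed

text \<open>Solutions without mean constraints have the expected means: the test function 1 in the first
  equation shows that the mean of \<open>\<Phi>\<close> is the one of the previous step, and in the second equation that
  the mean of \<open>M\<close> is the shift. Subtracting the means gives the preimage.\<close>

lemma A_to_B_surj:
  assumes sol: "(\<Phi>, M) \<in> solutions_B \<Omega> \<T> \<alpha> \<epsilon> \<tau> \<phi>prev"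
    and prev: "\<And>x. x \<in> C \<Longrightarrow> \<phi>prev x = \<phi>p x + \<phi>bar"
  obtains \<phi> \<mu> where "\<phi> \<in> PP0 2" "\<phi> \<in> extensional C" "\<mu> \<in> PP0 1" "\<mu> \<in> extensional C"
    "A_to_B \<Omega> \<epsilon> \<phi>bar (\<phi>, \<mu>) = (\<Phi>, M)"
proof -
  let ?o = "\<lambda>x\<in>C. 1 :: real"
  have B: "\<Phi> \<in> PP 2" "\<Phi> \<in> extensional C" "M \<in> PP 1" "M \<in> extensional C"
    "\<And>\<nu>. \<nu> \<in> PP 1 \<Longrightarrow> \<nu> \<in> extensional C \<Longrightarrow> mass (\<lambda>x. (\<Phi> x - \<phi>prev x) / \<tau>) \<nu> + stiff M \<nu> = 0"
    "\<And>\<psi>. \<psi> \<in> PP 2 \<Longrightarrow> \<psi> \<in> extensional C \<Longrightarrow> a_IP \<T> \<alpha> \<Phi> \<psi>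
        + mass (\<lambda>x. (\<Phi> x) ^ 3 + (1 - \<epsilon>) * \<Phi> x) \<psi> - 2 * stiff \<phi>prev \<psi> - mass M \<psi> = 0"
    using sol unfolding solutions_B_def Zh_def Vh_def FE_space_eq by auto
  have prevP: "\<phi>prev \<in> PP 2" using prev by (rule PP_cong[OF _ PP_shift[OF PP0_PP[OF \<phi>p]]])
  have op: "?o \<in> PP k" for k by (intro PP_restrict PP_const)
  have mo: "mass g ?o = mass g (\<lambda>_. 1)" for g by (rule mass_cong) auto
  have so: "stiff g ?o = 0" if "g \<in> PP 2" for g
    using stiff_lincomb_right[OF PP_const[of 1] PP_const[of 1] that, of ?o 1 0] stiff_const_right[OF that] by simp
  have ao: "a_IP \<T> \<alpha> g ?o = 0" if "g \<in> PP 2" for g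
    using a_IP_lincomb_right[OF PP_const[of 1] PP_const[of 1] that, of ?o 1 0 \<alpha>]
      a_IP_const_right[OF that, of \<alpha> 1] by simp
  define \<phi> where "\<phi> = (\<lambda>x\<in>C. \<Phi> x - \<phi>bar)"
  define \<mu> where "\<mu> = (\<lambda>x\<in>C. M x - mu_shift \<phi>)"
  have \<phi>P: "\<phi> \<in> PP 2" using PP_restrict[OF PP_shift[OF B(1), of "- \<phi>bar"]] by (simp add: \<phi>_def)
  have \<mu>P: "\<mu> \<in> PP 1" using PP_restrict[OF PP_shift[OF B(3), of "- mu_shift \<phi>"]] by (simp add: \<mu>_def)
  have "0 = mass (\<lambda>x. (\<Phi> x - \<phi>prev x) / \<tau>) (\<lambda>_. 1)"
    using B(5)[OF op restrict_extensional] so[OF PP1_PP2[OF B(3)]] mo by simp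
  also have "\<dots> = mass (\<lambda>x. (\<phi> x - \<phi>p x) / \<tau>) (\<lambda>_. 1)"
    by (rule mass_cong) (simp_all add: \<phi>_def prev)
  also have "\<dots> = (1/\<tau>) * (mass \<phi> (\<lambda>_. 1) - mass \<phi>p (\<lambda>_. 1))"
    by (rule mass_increment[OF \<phi>P PP_const[of 1 1]])
  finally have m\<phi>: "mass \<phi> (\<lambda>_. 1) = 0" using \<tau> PP0_mean[OF \<phi>p] by simp
  have \<phi>0: "\<phi> \<in> PP0 2" using \<phi>P m\<phi> by (simp add: PP0_def)
  have cq: "continuous_on C (\<lambda>x. (\<phi> x + \<phi>bar) ^ 3)" "continuous_on C (\<lambda>x. \<phi> x + \<phi>bar)"
    by (intro continuous_intros PP_cont[OF \<phi>P])+
  have "mass M (\<lambda>_. 1) = mass (\<lambda>x. (\<Phi> x) ^ 3 + (1 - \<epsilon>) * \<Phi> x) (\<lambda>_. 1)"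
    using B(6)[OF op restrict_extensional] so[OF prevP] ao[OF B(1)] mo by simp
  also have "\<dots> = 1 * mass (\<lambda>x. (\<phi> x + \<phi>bar) ^ 3) (\<lambda>_. 1) + (1 - \<epsilon>) * mass (\<lambda>x. \<phi> x + \<phi>bar) (\<lambda>_. 1)"
    by (rule mass_lincomb[OF _ cq]) (auto simp: \<phi>_def)
  also have "mass (\<lambda>x. \<phi> x + \<phi>bar) (\<lambda>_. 1) = 1 * mass \<phi> (\<lambda>_. 1) + \<phi>bar * mass (\<lambda>_. 1 :: real) (\<lambda>_. 1)"
    by (rule mass_lincomb[OF _ PP_cont[OF \<phi>P]]) auto
  also have "\<dots> = \<phi>bar * measure lebesgue \<Omega>" using m\<phi> mass_one[of 1] by simp
  finally have mM: "mass M (\<lambda>_. 1) = mu_shift \<phi> * measure lebesgue \<Omega>"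
    by (simp add: mu_shift_measure)
  have "mass \<mu> (\<lambda>_. 1) = 1 * mass M (\<lambda>_. 1) + (- mu_shift \<phi>) * mass (\<lambda>_. 1 :: real) (\<lambda>_. 1)"
    by (rule mass_lincomb[OF _ PP_cont[OF B(3)]]) (auto simp: \<mu>_def)
  then have \<mu>0: "\<mu> \<in> PP0 1" using \<mu>P mM mass_one[of 1] by (simp add: PP0_def)
  have "A_to_B \<Omega> \<epsilon> \<phi>bar (\<phi>, \<mu>) = (\<Phi>, M)"
    unfolding A_to_B_eq using B(2,4)
    by (auto intro!: extensionalityI[where A = C] simp: \<phi>_def \<mu>_def)
  then show ?thesis using that \<phi>0 \<mu>0 by (auto simp: \<phi>_def \<mu>_def)
qed

lemma A_to_B_inj: "inj_on (A_to_B \<Omega> \<epsilon> \<phi>bar) (extensional C \<times> extensional C)"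
proof (rule inj_onI)
  fix s t assume s: "s \<in> extensional C \<times> extensional C" and t: "t \<in> extensional C \<times> extensional C"
    and eq: "A_to_B \<Omega> \<epsilon> \<phi>bar s = A_to_B \<Omega> \<epsilon> \<phi>bar t"
  obtain \<phi>1 \<mu>1 \<phi>2 \<mu>2 where st: "s = (\<phi>1, \<mu>1)" "t = (\<phi>2, \<mu>2)" by fastforce
  have e: "(\<lambda>x\<in>C. \<phi>1 x + \<phi>bar) = (\<lambda>x\<in>C. \<phi>2 x + \<phi>bar)"
    "(\<lambda>x\<in>C. \<mu>1 x + mu_shift \<phi>1) = (\<lambda>x\<in>C. \<mu>2 x + mu_shift \<phi>2)"
    using eq unfolding st A_to_B_eq by auto
  have "\<phi>1 x = \<phi>2 x" if "x \<in> C" for x using fun_cong[OF e(1), of x] that by simp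
  then have \<phi>: "\<phi>1 = \<phi>2" using s t unfolding st by (auto intro: extensionalityI)
  have "\<mu>1 x = \<mu>2 x" if "x \<in> C" for x using fun_cong[OF e(2), of x] that \<phi> by simp
  then have "\<mu>1 = \<mu>2" using s t unfolding st by (auto intro: extensionalityI)
  with \<phi> show "s = t" by (simp add: st)
qed

end

theorem theorem3p1:
  fixes \<Omega> :: "(real^2) set" and \<T> :: "(real^2) set set"
    and h \<kappa> \<tau> \<epsilon> \<alpha> C_coer \<phi>bar :: real
    and \<phi>prev \<phi>prev_ring :: "real^2 \<Rightarrow> real"
  assumes "polygonal_domain \<Omega>"
    and "triangulates \<T> \<Omega>" and "locally_quasi_uniform \<kappa> \<T>"
    and "mesh_size \<T> = h" and "h > 0"
    and "\<tau> > 0" and "\<epsilon> < 1" and "\<alpha> \<ge> 1"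
    and "C_coer > 0"
    and "\<forall>w\<in>Zh \<Omega> \<T>. C_coer * (norm_2h \<T> \<alpha> w)\<^sup>2 \<le> a_IP \<T> \<alpha> w w"
    and "\<phi>prev \<in> Zh \<Omega> \<T>"
    and "1 / measure lebesgue \<Omega> * L2_ip \<Omega> \<phi>prev (\<lambda>x. 1) = \<phi>bar"
    and "\<phi>prev_ring = (\<lambda>x\<in>closure \<Omega>. \<phi>prev x - \<phi>bar)"
  shows "(\<exists>!s. s \<in> solutions_A \<Omega> \<T> \<alpha> \<epsilon> \<tau> \<phi>bar \<phi>prev_ring) \<and>
    (\<forall>\<phi>\<in>Zh0 \<Omega> \<T>. \<forall>\<mu>\<in>Vh0 \<Omega> \<T>.
        (\<phi>, \<mu>) \<in> solutions_A \<Omega> \<T> \<alpha> \<epsilon> \<tau> \<phi>bar \<phi>prev_ring \<longleftrightarrow>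
        A_to_B \<Omega> \<epsilon> \<phi>bar (\<phi>, \<mu>) \<in> solutions_B \<Omega> \<T> \<alpha> \<epsilon> \<tau> \<phi>prev) \<and>
    bij_betw (A_to_B \<Omega> \<epsilon> \<phi>bar)
      (solutions_A \<Omega> \<T> \<alpha> \<epsilon> \<tau> \<phi>bar \<phi>prev_ring) (solutions_B \<Omega> \<T> \<alpha> \<epsilon> \<tau> \<phi>prev) \<and>
    (\<exists>!s. s \<in> solutions_B \<Omega> \<T> \<alpha> \<epsilon> \<tau> \<phi>prev)"
proof -
  interpret fe_mesh \<Omega> \<T> using assms(1,2) by unfold_locales
  have prevP: "\<phi>prev \<in> PP 2" using assms(11) by (simp add: Zh_def FE_space_eq)
  have ringP: "\<phi>prev_ring \<in> PP 2"
    using PP_restrict[OF PP_shift[OF prevP, of "- \<phi>bar"]] by (simp add: assms(13))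
  have "L2_ip \<Omega> \<phi>prev_ring (\<lambda>_. 1) = 1 * L2_ip \<Omega> \<phi>prev (\<lambda>_. 1) + (- \<phi>bar) * L2_ip \<Omega> (\<lambda>_. 1 :: real) (\<lambda>_. 1)"
    by (rule mass_lincomb[OF _ PP_cont[OF prevP]]) (auto simp: assms(13))
  also have "\<dots> = 0" using assms(12) mass_one[of 1] measure_domain(1) by (auto simp: field_simps)
  finally have ring0: "\<phi>prev_ring \<in> PP0 2" using ringP by (simp add: PP0_def)
  interpret time_step \<Omega> \<T> \<alpha> \<epsilon> \<tau> \<phi>bar \<phi>prev_ring
  proof unfold_locales
    fix w assume w: "w \<in> PP 2"
    have z: "restrict w C \<in> Zh \<Omega> \<T>" using PP_restrict[OF w] by (simp add: Zh_def FE_space_eq)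
    have "0 \<le> C_coer * (norm_2h \<T> \<alpha> (restrict w C))\<^sup>2" using assms(9) by simp
    also have "\<dots> \<le> a_IP \<T> \<alpha> (restrict w C) (restrict w C)" using assms(10) z by blast
    also have "\<dots> = a_IP \<T> \<alpha> w (restrict w C)"
      using a_IP_lincomb[OF w w PP_restrict[OF w], of "restrict w C" 1 0 \<alpha>] by simp
    also have "\<dots> = a_IP \<T> \<alpha> w w"
      using a_IP_lincomb_right[OF w w w, of "restrict w C" 1 0 \<alpha>] by simp
    finally show "0 \<le> a_IP \<T> \<alpha> w w" .
  qed (use assms ring0 in auto)
  let ?A = "solutions_A \<Omega> \<T> \<alpha> \<epsilon> \<tau> \<phi>bar \<phi>prev_ring" and ?B = "solutions_B \<Omega> \<T> \<alpha> \<epsilon> \<tau> \<phi>prev"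
  let ?f = "A_to_B \<Omega> \<epsilon> \<phi>bar"
  have prev: "\<phi>prev x = \<phi>prev_ring x + \<phi>bar" if "x \<in> C" for x using that by (simp add: assms(13))
  have equiv: "(\<phi>, \<mu>) \<in> ?A \<longleftrightarrow> ?f (\<phi>, \<mu>) \<in> ?B"
    if "\<phi> \<in> PP0 2" "\<phi> \<in> extensional C" "\<mu> \<in> PP0 1" "\<mu> \<in> extensional C" for \<phi> \<mu>
    using solutions_A_iff_B[OF that prev] .
  have bij: "bij_betw ?f ?A ?B" unfolding bij_betw_def
  proof
    show "inj_on ?f ?A" by (rule inj_on_subset[OF A_to_B_inj]) (auto simp: solutions_A_iff)
    show "?f ` ?A = ?B"
    proof
      show "?f ` ?A \<subseteq> ?B"
      proof (rule image_subsetI)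
        fix s assume s: "s \<in> ?A"
        obtain \<phi> \<mu> where st: "s = (\<phi>, \<mu>)" by fastforce
        have "\<phi> \<in> PP0 2" "\<phi> \<in> extensional C" "\<mu> \<in> PP0 1" "\<mu> \<in> extensional C"
          using s unfolding st solutions_A_iff weak_solution_def by auto
        from equiv[OF this] show "?f s \<in> ?B" using s st by simp
      qed
      show "?B \<subseteq> ?f ` ?A"
      proof
        fix t assume t: "t \<in> ?B"
        obtain \<Phi> M where tt: "t = (\<Phi>, M)" by fastforce
        obtain \<phi> \<mu> where s: "\<phi> \<in> PP0 2" "\<phi> \<in> extensional C" "\<mu> \<in> PP0 1" "\<mu> \<in> extensional C"
          and f: "?f (\<phi>, \<mu>) = (\<Phi>, M)"
          by (rule A_to_B_surj[OF t[unfolded tt] prev])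
        have "(\<phi>, \<mu>) \<in> ?A" using equiv[OF s] f t tt by simp
        then show "t \<in> ?f ` ?A" using f tt by (metis image_eqI)
      qed
    qed
  qed
  have exA: "\<exists>!s. s \<in> ?A" by (rule solutions_A_ex1)
  then obtain s where "?A = {s}" by blast
  then have "?B = {?f s}" using bij by (simp add: bij_betw_def)
  then have exB: "\<exists>!s. s \<in> ?B" by simp
  have "\<forall>\<phi>\<in>Zh0 \<Omega> \<T>. \<forall>\<mu>\<in>Vh0 \<Omega> \<T>. (\<phi>, \<mu>) \<in> ?A \<longleftrightarrow> ?f (\<phi>, \<mu>) \<in> ?B"
    unfolding Zh0_def Vh0_def Zh_def Vh_def FE_space_zero_mean using equiv by blast
  then show ?thesis using exA bij exB by blast
qed

end
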